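(* Let $\mathbf{Ab}$ be the variety of all Abelian groups. A finite connected directed graph $\Gamma$ contains a breaking path over $\mathbf{Ab}$ if and only if $\Theta_1$ or $\Theta_2$ is a minor of $\Gamma$, where: $\Theta_1$ has vertices $u,v,w$ and edges $a,b$ from $u$ to $v$, $c$ from $w$ to $u$, and $d$ from $w$ to $v$; and $\Theta_2$ has vertices $u,v,w$ and edges $a,b$ from $u$ to $v$ and $c,d$ from $w$ to $u$.
   Context: All graphs are finite directed graphs, possibly with loops and multiple edges. A graph $\Gamma$ has vertex set $V(\Gamma)$ and edge set $E(\Gamma)$, and each edge $e$ has an initial vertex $\iota e$ and a terminal vertex $\tau e$. A subgraph is regarded as a set of vertices and edges (containing the endpoints of its edges); unions and intersections of subgraphs are taken as sets of vertices and edges. Connectedness refers to the underlying undirected graph. Let $\overline{\Gamma}$ be the graph with vertex set $V(\Gamma)$ and edge set $E(\Gamma)\sqcup E(\Gamma)^{-1}$, where for $e\in E(\Gamma)$ the formal edge $e^{-1}$ goes from $\tau e$ to $\iota e$. A path $p$ in $\overline{\Gamma}$ is either an empty path at a vertex or a sequence $e_1\cdots e_n$ of edges of $\overline{\Gamma}$ with $\tau e_i=\iota e_{i+1}$; it has initial vertex $\iota p$ and terminal vertex $\tau p$, and is regarded as a word over the alphabet $E(\Gamma)\cup E(\Gamma)^{-1}$. The span $\langle p\rangle$ is the subgraph of $\Gamma$ consisting of the vertices traversed by $p$ and the edges $e\in E(\Gamma)$ such that $e$ or $e^{-1}$ occurs in $p$. For a group variety $\mathbf{U}$ and words $u,v$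 over $X\cup X^{-1}$, write $u\equiv_{\mathbf U} v$ if $u$ and $v$ represent the same element of the relatively free group of $\mathbf U$ on $X$ (i.e. the identity $u=v$ holds in $\mathbf U$), and $[u]_{\mathbf U}$ for the class of $u$. The free $g\mathbf U$-category on $\Gamma$ has vertex set $V(\Gamma)$; its arrows from $i$ to $j$ are the triples $(i,[p]_{\mathbf U},j)$ with $p$ an $(i,j)$-path in $\overline\Gamma$, and $(i,[p]_{\mathbf U},j)(j,[q]_{\mathbf U},k)=(i,[pq]_{\mathbf U},k)$; for an arrow $x=(i,[p]_{\mathbf U},j)$ put $\iota x=i$, $\tau x=j$. For each arrow $x$ define subgraphs of $\Gamma$: $C_0(x)=\bigcap\{\langle p\rangle : p \text{ a path in }\overline\Gamma \text{ with } (\iota p,[p]_{\mathbf U},\tau p)=x\}$; $P_n(x)$ is the connected component of $C_n(x)$ containing $\iota x$; $C_{n+1}(x)=\bigcap\{P_n(x_1)\cup\cdots\cup P_n(x_k) : k\ge 1,\ x_1,\dots,x_k \text{ arrows with } x_1\cdots x_k=x\}$; and $P(x)=\bigcap_{n\ge 0}P_n(x)$. For a connected graph $\Gamma$, a path $p$ in $\overline\Gamma$ is a breaking path over $\mathbf U$ if $\tau p\notin P(x)$ where $x=(\iota p,[p]_{\mathbf U},\tau p)$. A graph $\Delta$ is a minor of $\Gamma$ if $\Delta$ can be obtained from $\Gamma$ by a finite sequence of the following operations: contracting an edge $e$ with $\iota e\neq\tau e$ (removing $e$ and identifying its two endpoints into one vertex), deleting an edge, deleting a vertex together with its incident edges,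 and reversing the direction of an edge. (In particular the directions of the edges of $\Theta_1,\Theta_2$ are immaterial.) *)

theory Defs
  imports "Graph_Theory.Digraph_Component" "Graph_Theory.Digraph_Isomorphism"
          "HOL-Algebra.Free_Abelian_Groups"
begin

text \<open>A letter (e, True) is the edge e, a letter (e, False) is the formal inverse e^-1.
  A path is a start vertex together with a word of letters.\<close>

type_synonym 'e letter = "'e \<times> bool"
type_synonym ('v,'e) dpath = "'v \<times> 'e letter list"

definition dsrc :: "('v,'e) pre_digraph \<Rightarrow> 'e letter \<Rightarrow> 'v" where
  "dsrc G l = (if snd l then tail G (fst l) else head G (fst l))"

definition dtgt :: "('v,'e) pre_digraph \<Rightarrow> 'e letter \<Rightarrow> 'v" where
  "dtgt G l = (if snd l then head G (fst l) else tail G (fst l))"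

fun walk_ok :: "('v,'e) pre_digraph \<Rightarrow> 'v \<Rightarrow> 'e letter list \<Rightarrow> bool" where
  "walk_ok G v [] = (v \<in> verts G)"
| "walk_ok G v (l # ls) =
     (v \<in> verts G \<and> fst l \<in> arcs G \<and> dsrc G l = v \<and> walk_ok G (dtgt G l) ls)"

fun walk_end :: "('v,'e) pre_digraph \<Rightarrow> 'v \<Rightarrow> 'e letter list \<Rightarrow> 'v" where
  "walk_end G v [] = v"
| "walk_end G v (l # ls) = walk_end G (dtgt G l) ls"

definition is_dpath :: "('v,'e) pre_digraph \<Rightarrow> ('v,'e) dpath \<Rightarrow> bool" where
  "is_dpath G p = walk_ok G (fst p) (snd p)"

definition dpath_end :: "('v,'e) pre_digraph \<Rightarrow> ('v,'e) dpath \<Rightarrow> 'v" where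
  "dpath_end G p = walk_end G (fst p) (snd p)"

text \<open>The class [p]_Ab of a word is its value in free_Abelian_group,
  whose carrier consists of finitely supported poly_mappings to int with group operation (+).\<close>

definition ab_class :: "'e letter list \<Rightarrow> 'e \<Rightarrow>\<^sub>0 int" where
  "ab_class w = sum_list (map (\<lambda>l. if snd l then frag_of (fst l) else - frag_of (fst l)) w)"

type_synonym ('v,'e) arrow = "'v \<times> ('e \<Rightarrow>\<^sub>0 int) \<times> 'v"

definition arrow_of :: "('v,'e) pre_digraph \<Rightarrow> ('v,'e) dpath \<Rightarrow> ('v,'e) arrow" where
  "arrow_of G p = (fst p, ab_class (snd p), dpath_end G p)"

definition arrows :: "('v,'e) pre_digraph \<Rightarrow> ('v,'e) arrow set" where
  "arrows G = arrow_of G ` {p. is_dpath G p}"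

definition arr_src :: "('v,'e) arrow \<Rightarrow> 'v" where "arr_src x = fst x"
definition arr_tgt :: "('v,'e) arrow \<Rightarrow> 'v" where "arr_tgt x = snd (snd x)"

definition arr_comp :: "('v,'e) arrow \<Rightarrow> ('v,'e) arrow \<Rightarrow> ('v,'e) arrow" where
  "arr_comp x y = (fst x, fst (snd x) + fst (snd y), snd (snd y))"

fun arr_chain :: "('v,'e) arrow list \<Rightarrow> bool" where
  "arr_chain (x # y # xs) = (arr_tgt x = arr_src y \<and> arr_chain (y # xs))"
| "arr_chain _ = True"

fun arr_prod :: "('v,'e) arrow list \<Rightarrow> ('v,'e) arrow" where
  "arr_prod [x] = x"
| "arr_prod (x # y # xs) = arr_comp x (arr_prod (y # xs))"
| "arr_prod [] = undefined"

definition factorizations :: "('v,'e) pre_digraph \<Rightarrow> ('v,'e) arrow \<Rightarrow> ('v,'e) arrow list set" where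
  "factorizations G x = {xs. xs \<noteq> [] \<and> set xs \<subseteq> arrows G \<and> arr_chain xs \<and> arr_prod xs = x}"

type_synonym ('v,'e) sg = "'v set \<times> 'e set"

definition sg_Inter :: "('v,'e) sg set \<Rightarrow> ('v,'e) sg" where
  "sg_Inter S = (\<Inter> (fst ` S), \<Inter> (snd ` S))"

definition sg_Union :: "('v,'e) sg list \<Rightarrow> ('v,'e) sg" where
  "sg_Union hs = (\<Union> (fst ` set hs), \<Union> (snd ` set hs))"

definition span :: "('v,'e) pre_digraph \<Rightarrow> ('v,'e) dpath \<Rightarrow> ('v,'e) sg" where
  "span G p = (set (fst p # map (dtgt G) (snd p)), fst ` set (snd p))"

definition component :: "('v,'e) pre_digraph \<Rightarrow> ('v,'e) sg \<Rightarrow> 'v \<Rightarrow> ('v,'e) sg" where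
  "component G H v =
    (let R = {w \<in> fst H. (v, w) \<in>
               (\<Union>e\<in>snd H. {(tail G e, head G e), (head G e, tail G e)})\<^sup>*}
     in (R, {e \<in> snd H. tail G e \<in> R \<and> head G e \<in> R}))"

definition C0 :: "('v,'e) pre_digraph \<Rightarrow> ('v,'e) arrow \<Rightarrow> ('v,'e) sg" where
  "C0 G x = sg_Inter {span G p | p. is_dpath G p \<and> arrow_of G p = x}"

primrec Cseq :: "('v,'e) pre_digraph \<Rightarrow> nat \<Rightarrow> ('v,'e) arrow \<Rightarrow> ('v,'e) sg" where
  "Cseq G 0 = C0 G"
| "Cseq G (Suc n) = (\<lambda>x. sg_Inter
     {sg_Union (map (\<lambda>y. component G (Cseq G n y) (arr_src y)) xs) | xs. xs \<in> factorizations G x})"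

definition Pseq :: "('v,'e) pre_digraph \<Rightarrow> nat \<Rightarrow> ('v,'e) arrow \<Rightarrow> ('v,'e) sg" where
  "Pseq G n x = component G (Cseq G n x) (arr_src x)"

definition Plim :: "('v,'e) pre_digraph \<Rightarrow> ('v,'e) arrow \<Rightarrow> ('v,'e) sg" where
  "Plim G x = sg_Inter (range (\<lambda>n. Pseq G n x))"

definition breaking_path_Ab :: "('v,'e) pre_digraph \<Rightarrow> ('v,'e) dpath \<Rightarrow> bool" where
  "breaking_path_Ab G p \<longleftrightarrow> connected G \<and> is_dpath G p \<and>
     dpath_end G p \<notin> fst (Plim G (arrow_of G p))"

definition contract_arc :: "('v,'e) pre_digraph \<Rightarrow> 'e \<Rightarrow> ('v,'e) pre_digraph" where
  "contract_arc G e =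
    \<lparr> verts = verts G - {head G e}, arcs = arcs G - {e},
      tail = (\<lambda>a. if tail G a = head G e then tail G e else tail G a),
      head = (\<lambda>a. if head G a = head G e then tail G e else head G a) \<rparr>"

definition reverse_arc :: "('v,'e) pre_digraph \<Rightarrow> 'e \<Rightarrow> ('v,'e) pre_digraph" where
  "reverse_arc G e =
    \<lparr> verts = verts G, arcs = arcs G,
      tail = (tail G)(e := head G e), head = (head G)(e := tail G e) \<rparr>"

definition minor_step :: "('v,'e) pre_digraph \<Rightarrow> ('v,'e) pre_digraph \<Rightarrow> bool" where
  "minor_step G H \<longleftrightarrow>
     (\<exists>e\<in>arcs G. tail G e \<noteq> head G e \<and> H = contract_arc G e)
   \<or> (\<exists>e\<in>arcs G. H = pre_digraph.del_arc G e)
   \<or> (\<exists>v\<in>verts G. H = pre_digraph.del_vert G v)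
   \<or> (\<exists>e\<in>arcs G. H = reverse_arc G e)"

definition is_minor :: "('a,'b) pre_digraph \<Rightarrow> ('v,'e) pre_digraph \<Rightarrow> bool" where
  "is_minor D G \<longleftrightarrow> (\<exists>H. minor_step\<^sup>*\<^sup>* G H \<and> digraph_iso D H)"

text \<open>Theta graphs: u = 0, v = 1, w = 2; a = 0, b = 1, c = 2, d = 3.\<close>
definition Theta1 :: "(nat, nat) pre_digraph" where
  "Theta1 = \<lparr> verts = {0, 1, 2}, arcs = {0, 1, 2, 3},
     tail = (\<lambda>e. if e = 2 \<or> e = 3 then 2 else 0),
     head = (\<lambda>e. if e = 2 then 0 else 1) \<rparr>"

definition Theta2 :: "(nat, nat) pre_digraph" where
  "Theta2 = \<lparr> verts = {0, 1, 2}, arcs = {0, 1, 2, 3},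
     tail = (\<lambda>e. if e = 2 \<or> e = 3 then 2 else 0),
     head = (\<lambda>e. if e = 2 \<or> e = 3 then 0 else 1) \<rparr>"

end

theory Submission
  imports Defs
begin

text \<open>
  Both excluded minors are captured by one kind of minor model: disjoint connected vertex sets \<open>M\<close>, \<open>T\<close>, \<open>S\<close>
  with two edges \<open>p\<close>, \<open>q\<close> between \<open>M\<close> and \<open>T\<close>, an edge \<open>s\<close> between \<open>S\<close> and \<open>M\<close>, and an edge \<open>s'\<close>
  between \<open>S\<close> and \<open>M \<union> T\<close>; the end of \<open>s'\<close> decides between \<open>\<Theta>\<^sub>1\<close> and \<open>\<Theta>\<^sub>2\<close>.

  Given such a model, the path through \<open>s\<close>, \<open>M\<close> and \<open>p\<close> breaks at level 1.

  Conversely, attach to an arrow \<open>x\<close> from \<open>i\<close> to \<open>j\<close> its core: the non-loop non-bridges on which its class is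
  nonzero, and the bridges that separate \<open>i\<close> from \<open>j\<close> or from one of those edges. The core lies in \<open>C\<^sub>0(x)\<close> and
  the core of a product is contained in the union of the cores of the factors. Hence, if all cores are
  connected, the core stays inside every \<open>P\<^sub>n(x)\<close>, and it contains \<open>j\<close>. A disconnected core yields a model.
\<close>

section \<open>Links, walks and their classes\<close>

text \<open>The relation whose closure is written out inside \<open>component\<close>; naming it
  lets components, connected sets and separation share one notion of reachability.\<close>

definition links :: "('v,'e) pre_digraph \<Rightarrow> 'e set \<Rightarrow> ('v \<times> 'v) set" where
  "links G E = (\<Union>e\<in>E. {(tail G e, head G e), (head G e, tail G e)})"

definition induced_arcs :: "('v,'e) pre_digraph \<Rightarrow> 'v set \<Rightarrow> 'e set" where
  "induced_arcs G X = {e \<in> arcs G. tail G e \<in> X \<and> head G e \<in> X}"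

definition connected_set :: "('v,'e) pre_digraph \<Rightarrow> 'v set \<Rightarrow> bool" where
  "connected_set G X \<longleftrightarrow> X \<noteq> {} \<and> (\<forall>u\<in>X. \<forall>v\<in>X. (u, v) \<in> (links G (induced_arcs G X))\<^sup>*)"

definition joins :: "('v,'e) pre_digraph \<Rightarrow> 'e \<Rightarrow> 'v set \<Rightarrow> 'v set \<Rightarrow> bool" where
  "joins G e A B \<longleftrightarrow> e \<in> arcs G \<and>
     (tail G e \<in> A \<and> head G e \<in> B \<or> head G e \<in> A \<and> tail G e \<in> B)"

lemma linksI: "e \<in> E \<Longrightarrow> (tail G e, head G e) \<in> links G E" "e \<in> E \<Longrightarrow> (head G e, tail G e) \<in> links G E"
  by (auto simp: links_def)

lemma linksE:
  assumes "(u, v) \<in> links G E"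
  obtains e where "e \<in> E" "u = tail G e" "v = head G e" | e where "e \<in> E" "u = head G e" "v = tail G e"
  using assms by (auto simp: links_def)

lemma links_rtrancl_mono: "E \<subseteq> F \<Longrightarrow> (u, v) \<in> (links G E)\<^sup>* \<Longrightarrow> (u, v) \<in> (links G F)\<^sup>*"
  using rtrancl_mono[of "links G E" "links G F"] by (auto simp: links_def)

lemma sym_links: "sym (links G E)"
  by (auto simp: links_def sym_def)

lemma links_rtrancl_sym: "(u, v) \<in> (links G E)\<^sup>* \<Longrightarrow> (v, u) \<in> (links G E)\<^sup>*"
  using sym_rtrancl[OF sym_links] by (meson symD)

text \<open>The cut argument used throughout: a vertex is unreachable once some set contains the
  start, misses that vertex and is crossed by no edge of \<open>E\<close>.\<close>

lemma links_rtrancl_closed: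
  assumes "(u, v) \<in> (links G E)\<^sup>*" "u \<in> X" "\<And>e. e \<in> E \<Longrightarrow> tail G e \<in> X \<longleftrightarrow> head G e \<in> X"
  shows "v \<in> X"
  using assms(1,2)
proof induction
  case (step y z)
  then have "y \<in> X" by simp
  with step(2) assms(3) show ?case by (elim linksE) auto
qed

lemma links_reach_subset:
  assumes "u \<in> X" "\<And>e. e \<in> E \<Longrightarrow> tail G e \<in> X \<and> head G e \<in> X"
  shows "{v. (u, v) \<in> (links G E)\<^sup>*} \<subseteq> X"
  using links_rtrancl_closed[of u _ G E X] assms by blast

lemma links_reach_iff:
  "e \<in> E \<Longrightarrow> (u, tail G e) \<in> (links G E)\<^sup>* \<longleftrightarrow> (u, head G e) \<in> (links G E)\<^sup>*"
  by (meson linksI rtrancl.rtrancl_into_rtrancl)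

lemma links_rtrancl_restrict:
  assumes "(u, v) \<in> (links G E)\<^sup>*" "u \<in> X"
    "\<And>e. e \<in> E \<Longrightarrow> tail G e \<in> X \<longleftrightarrow> head G e \<in> X"
  shows "(u, v) \<in> (links G {e \<in> E. tail G e \<in> X \<and> head G e \<in> X})\<^sup>*"
  using assms(1)
proof induction
  case (step y z)
  have "y \<in> X" using links_rtrancl_closed[OF step(1) assms(2,3)] by blast
  with step(2) assms(3) have "(y, z) \<in> links G {e \<in> E. tail G e \<in> X \<and> head G e \<in> X}"
    by (auto simp: links_def)
  with step(3) show ?case by (rule rtrancl.rtrancl_into_rtrancl)
qed simp

lemma connected_links:
  assumes "connected G" "u \<in> verts G" "v \<in> verts G"
  shows "(u, v) \<in> (links G (arcs G))\<^sup>*"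
proof -
  have "(arcs_ends G)\<^sup>s = links G (arcs G)"
    by (auto simp: links_def symcl_def arcs_ends_conv)
  with assms show ?thesis
    by (metis connected_conv rtrancl_on_rtranclI)
qed

text \<open>A path from \<open>u\<close> never leaves the set of vertices reached, so it uses only
  arcs induced there. Reachability classes are thus a source of connected sets for models.\<close>

lemma connected_set_reach:
  assumes "E \<subseteq> arcs G"
  shows "connected_set G {v. (u, v) \<in> (links G E)\<^sup>*}" (is "connected_set G ?X")
proof -
  have *: "(u, v) \<in> (links G {e \<in> E. tail G e \<in> ?X \<and> head G e \<in> ?X})\<^sup>*" if "v \<in> ?X" for v
    by (rule links_rtrancl_restrict) (use that links_reach_iff[of _ E u G] in auto)
  have **: "{e \<in> E. tail G e \<in> ?X \<and> head G e \<in> ?X} \<subseteq> induced_arcs G ?X"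
    using assms by (auto simp: induced_arcs_def)
  have 1: "v \<in> ?X \<Longrightarrow> (u, v) \<in> (links G (induced_arcs G ?X))\<^sup>*" for v
    by (rule links_rtrancl_mono[OF ** *])
  have "(v, w) \<in> (links G (induced_arcs G ?X))\<^sup>*" if "v \<in> ?X" "w \<in> ?X" for v w
    using links_rtrancl_sym[OF 1[OF that(1)]] 1[OF that(2)] by (rule rtrancl_trans)
  moreover have "?X \<noteq> {}" by blast
  ultimately show ?thesis
    unfolding connected_set_def by simp
qed

lemma walk_ok_append:
  "walk_ok G u (w @ w') \<longleftrightarrow> walk_ok G u w \<and> walk_ok G (walk_end G u w) w'"
proof (induction w arbitrary: u)
  case Nil
  show ?case by (cases w') auto
qed auto

lemma walk_end_append: "walk_end G u (w @ w') = walk_end G (walk_end G u w) w'"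
  by (induction w arbitrary: u) auto

lemma walk_ok_verts: "walk_ok G u w \<Longrightarrow> u \<in> verts G \<and> walk_end G u w \<in> verts G"
  by (induction w arbitrary: u) auto

lemma walk_ok_arcs: "walk_ok G u w \<Longrightarrow> fst ` set w \<subseteq> arcs G"
  by (induction w arbitrary: u) auto

lemma letter_link: "fst l \<in> E \<Longrightarrow> (dsrc G l, dtgt G l) \<in> links G E"
  by (auto simp: dsrc_def dtgt_def linksI)

lemma walk_links_span:
  "walk_ok G u w \<Longrightarrow> fst ` set w \<subseteq> E \<Longrightarrow> v \<in> fst (span G (u, w)) \<Longrightarrow> (u, v) \<in> (links G E)\<^sup>*"
proof (induction w arbitrary: u)
  case (Cons l w)
  have l: "(u, dtgt G l) \<in> links G E" using Cons.prems letter_link[of l E G] by auto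
  show ?case
  proof (cases "v = u")
    case False
    then have "v \<in> fst (span G (dtgt G l, w))" using Cons.prems by (auto simp: span_def)
    with Cons have "(dtgt G l, v) \<in> (links G E)\<^sup>*" by auto
    with l show ?thesis by simp
  qed simp
qed (simp add: span_def)

lemma walk_end_in_span: "walk_end G u w \<in> fst (span G (u, w))"
  by (induction w arbitrary: u) (auto simp: span_def)

lemma span_arc_ends:
  "walk_ok G u w \<Longrightarrow> e \<in> fst ` set w \<Longrightarrow> tail G e \<in> fst (span G (u, w)) \<and> head G e \<in> fst (span G (u, w))"
proof (induction w arbitrary: u)
  case (Cons l w)
  show ?case
  proof (cases "e = fst l")
    case True
    with Cons.prems show ?thesis by (auto simp: span_def dsrc_def dtgt_def split: if_splits)
  next
    case False
    have "fst (span G (dtgt G l, w)) \<subseteq> fst (span G (u, l # w))" by (auto simp: span_def)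
    moreover have "walk_ok G (dtgt G l) w" "e \<in> fst ` set w" using False Cons.prems by auto
    ultimately show ?thesis using Cons.IH by blast
  qed
qed simp

lemma links_walk:
  assumes "(u, v) \<in> (links G E)\<^sup>*" "E \<subseteq> arcs G" "u \<in> verts G" "wf_digraph G"
  shows "\<exists>w. walk_ok G u w \<and> walk_end G u w = v \<and> fst ` set w \<subseteq> E"
  using assms(1)
proof induction
  case base
  show ?case by (rule exI[of _ "[]"]) (use assms in auto)
next
  case (step y z)
  interpret wf_digraph G by fact
  obtain w where w: "walk_ok G u w" "walk_end G u w = y" "fst ` set w \<subseteq> E" using step by auto
  obtain l where l: "fst l \<in> E" "dsrc G l = y" "dtgt G l = z"
    using step(2)
  proof (cases rule: linksE)
    case (1 e) then show ?thesis using that[of "(e, True)"] by (auto simp: dsrc_def dtgt_def)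
  next
    case (2 e) then show ?thesis using that[of "(e, False)"] by (auto simp: dsrc_def dtgt_def)
  qed
  have "fst l \<in> arcs G" using l assms by auto
  then have "y \<in> verts G" "z \<in> verts G" using l by (auto simp: dsrc_def dtgt_def split: if_splits)
  then have "walk_ok G u (w @ [l]) \<and> walk_end G u (w @ [l]) = z \<and> fst ` set (w @ [l]) \<subseteq> E"
    using w l \<open>fst l \<in> arcs G\<close> by (auto simp: walk_ok_append walk_end_append)
  then show ?case by blast
qed

definition inverse_word :: "'e letter list \<Rightarrow> 'e letter list" where
  "inverse_word w = rev (map (\<lambda>l. (fst l, \<not> snd l)) w)"

lemma set_inverse_word: "fst ` set (inverse_word w) = fst ` set w"
  by (force simp: inverse_word_def image_image)

lemma walk_inverse:
  "walk_ok G u w \<Longrightarrow> walk_ok G (walk_end G u w) (inverse_word w) \<and> walk_end G (walk_end G u w) (inverse_word w) = u"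
proof (induction w arbitrary: u)
  case (Cons l w)
  have 1: "inverse_word (l # w) = inverse_word w @ [(fst l, \<not> snd l)]" by (simp add: inverse_word_def)
  have 2: "walk_ok G (dtgt G l) w" using Cons.prems by auto
  have 3: "dsrc G (fst l, \<not> snd l) = dtgt G l" "dtgt G (fst l, \<not> snd l) = dsrc G l"
    by (auto simp: dsrc_def dtgt_def)
  show ?case using Cons.IH[OF 2] Cons.prems walk_ok_verts[OF 2]
    by (auto simp: 1 3 walk_ok_append walk_end_append)
qed (simp add: inverse_word_def)

lemma ab_class_append: "ab_class (w @ w') = ab_class w + ab_class w'"
  by (simp add: ab_class_def)

lemma ab_class_inverse: "ab_class (inverse_word w) = - ab_class w"
  by (induction w) (auto simp: inverse_word_def ab_class_def algebra_simps)

lemma ab_class_Cons: "ab_class (l # w) = (if snd l then frag_of (fst l) else - frag_of (fst l)) + ab_class w"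
  by (simp add: ab_class_def)

lemma ab_class_lookup_nonzero: "Poly_Mapping.lookup (ab_class w) e \<noteq> 0 \<Longrightarrow> e \<in> fst ` set w"
proof (induction w)
  case (Cons l w)
  then show ?case by (auto simp: ab_class_Cons lookup_add lookup_single when_def split: if_splits)
qed (simp add: ab_class_def)

section \<open>Cuts and the net crossing number of a walk\<close>

definition crossing :: "('v,'e) pre_digraph \<Rightarrow> 'v set \<Rightarrow> 'e \<Rightarrow> int" where
  "crossing G X e = of_bool (tail G e \<in> X) - of_bool (head G e \<in> X)"

text \<open>Flow conservation: each letter contributes membership of its source in \<open>X\<close>
  minus membership of its target, and the sum telescopes along the walk. So the class of a walk,
  paired with the signed cut of \<open>X\<close>, sees only the two ends of the walk.\<close>

lemma net_crossing:
  assumes "fin_digraph G" "walk_ok G u w"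
  shows "(\<Sum>e\<in>arcs G. Poly_Mapping.lookup (ab_class w) e * crossing G X e) = of_bool (u \<in> X) - of_bool (walk_end G u w \<in> X)"
  using assms(2)
proof (induction w arbitrary: u)
  case Nil
  then show ?case by (simp add: ab_class_def)
next
  case (Cons l w)
  interpret fin_digraph G by fact
  define c where "c = (if snd l then frag_of (fst l) else - frag_of (fst l) :: _ \<Rightarrow>\<^sub>0 int)"
  define \<epsilon> :: int where "\<epsilon> = (if snd l then 1 else -1)"
  have c: "Poly_Mapping.lookup c e = (if e = fst l then \<epsilon> else 0)" for e
    by (auto simp: c_def \<epsilon>_def lookup_single when_def)
  have "(\<Sum>e\<in>arcs G. Poly_Mapping.lookup c e * crossing G X e) = (\<Sum>e\<in>arcs G. if e = fst l then \<epsilon> * crossing G X (fst l) else 0)"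
    by (rule sum.cong) (auto simp: c)
  also have "\<dots> = \<epsilon> * crossing G X (fst l)"
    using Cons.prems by (simp add: sum.delta)
  also have "\<dots> = of_bool (u \<in> X) - of_bool (dtgt G l \<in> X)"
    using Cons.prems by (auto simp: \<epsilon>_def crossing_def dsrc_def dtgt_def)
  finally have 1: "(\<Sum>e\<in>arcs G. Poly_Mapping.lookup c e * crossing G X e) = of_bool (u \<in> X) - of_bool (dtgt G l \<in> X)" .
  have "(\<Sum>e\<in>arcs G. Poly_Mapping.lookup (ab_class (l # w)) e * crossing G X e)
      = (\<Sum>e\<in>arcs G. Poly_Mapping.lookup c e * crossing G X e) + (\<Sum>e\<in>arcs G. Poly_Mapping.lookup (ab_class w) e * crossing G X e)"
    unfolding ab_class_Cons c_def[symmetric] lookup_add distrib_right by (rule sum.distrib)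
  moreover have "walk_ok G (dtgt G l) w" using Cons.prems by simp
  ultimately show ?case using 1 Cons.IH[of "dtgt G l"] by simp
qed

lemma component_eq:
  "component G H v = ({w \<in> fst H. (v, w) \<in> (links G (snd H))\<^sup>*},
     {e \<in> snd H. tail G e \<in> fst H \<and> (v, tail G e) \<in> (links G (snd H))\<^sup>* \<and>
        head G e \<in> fst H \<and> (v, head G e) \<in> (links G (snd H))\<^sup>*})"
  by (auto simp: component_def Let_def links_def)

lemma component_subset:
  assumes "v \<in> X" "\<And>e. e \<in> snd H \<Longrightarrow> tail G e \<in> X \<longleftrightarrow> head G e \<in> X"
  shows "fst (component G H v) \<subseteq> X"
  using links_rtrancl_closed[OF _ assms] by (auto simp: component_eq)

section \<open>The core of an arrow\<close>

definition theta_model ::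
    "('v,'e) pre_digraph \<Rightarrow> 'v set \<Rightarrow> 'v set \<Rightarrow> 'v set \<Rightarrow> 'e \<Rightarrow> 'e \<Rightarrow> 'e \<Rightarrow> 'e \<Rightarrow> bool" where
  "theta_model G M T S p q s s' \<longleftrightarrow>
     M \<union> T \<union> S \<subseteq> verts G \<and> M \<inter> T = {} \<and> M \<inter> S = {} \<and> T \<inter> S = {} \<and>
     connected_set G M \<and> connected_set G T \<and> connected_set G S \<and>
     distinct [p, q, s, s'] \<and>
     joins G p M T \<and> joins G q M T \<and> joins G s S M \<and> joins G s' S (M \<union> T)"

definition separates :: "('v,'e) pre_digraph \<Rightarrow> 'e \<Rightarrow> 'v \<Rightarrow> 'v \<Rightarrow> bool" where
  "separates G e u v \<longleftrightarrow> e \<in> arcs G \<and> (u, v) \<notin> (links G (arcs G - {e}))\<^sup>*"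

text \<open>Not separating its own ends means that \<open>e\<close> is not a bridge. Loops are
  excluded because they cross no cut: a loop with nonzero coefficient may be cut off from the source
  in the core without any model being present.\<close>

definition cyclic_support :: "('v,'e) pre_digraph \<Rightarrow> ('e \<Rightarrow>\<^sub>0 int) \<Rightarrow> 'e set" where
  "cyclic_support G f = {e \<in> arcs G. Poly_Mapping.lookup f e \<noteq> 0 \<and> tail G e \<noteq> head G e \<and>
     \<not> separates G e (tail G e) (head G e)}"

text \<open>Testing only the tail of \<open>e'\<close> suffices: an arc other than \<open>e'\<close>
  cannot separate the two ends of \<open>e'\<close>, and \<open>e'\<close> itself is not a
  bridge.\<close>

definition core_arcs :: "('v,'e) pre_digraph \<Rightarrow> ('v,'e) arrow \<Rightarrow> 'e set" where
  "core_arcs G x = cyclic_support G (fst (snd x)) \<union>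
     {e. separates G e (arr_src x) (arr_tgt x) \<or>
        (\<exists>e'\<in>cyclic_support G (fst (snd x)). separates G e (arr_src x) (tail G e'))}"

text \<open>The source is inserted so that a core is never empty. The target is not inserted; its
  membership is derived in \<open>core_connected_if_no_theta_model\<close>.\<close>

definition core_verts :: "('v,'e) pre_digraph \<Rightarrow> ('v,'e) arrow \<Rightarrow> 'v set" where
  "core_verts G x = insert (arr_src x) (\<Union>e\<in>core_arcs G x. {tail G e, head G e})"

lemma separates_trans: "separates G e u w \<Longrightarrow> separates G e u v \<or> separates G e v w"
  unfolding separates_def by (meson rtrancl_trans)

lemma core_arcs_subset: "core_arcs G x \<subseteq> arcs G"
  by (auto simp: core_arcs_def cyclic_support_def separates_def)

text \<open>The support of a sum lies in the union of the supports. An arc separating the source of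
  \<open>x\<close> from a vertex relevant for \<open>y\<close> separates the source of
  \<open>x\<close> from the middle vertex, or the middle vertex from that vertex.\<close>

lemma core_arcs_comp:
  assumes "arr_tgt x = arr_src y"
  shows "core_arcs G (arr_comp x y) \<subseteq> core_arcs G x \<union> core_arcs G y"
proof
  fix e assume e: "e \<in> core_arcs G (arr_comp x y)"
  have supp: "cyclic_support G (fst (snd (arr_comp x y)))
      \<subseteq> cyclic_support G (fst (snd x)) \<union> cyclic_support G (fst (snd y))"
    by (auto simp: cyclic_support_def arr_comp_def lookup_add)
  have src: "arr_src (arr_comp x y) = arr_src x" "arr_tgt (arr_comp x y) = arr_tgt y"
    by (auto simp: arr_comp_def arr_src_def arr_tgt_def)
  consider (a) "e \<in> cyclic_support G (fst (snd x)) \<union> cyclic_support G (fst (snd y))"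
    | (b) "separates G e (arr_src x) (arr_tgt y)"
    | (c) e' where "e' \<in> cyclic_support G (fst (snd x))" "separates G e (arr_src x) (tail G e')"
    | (d) e' where "e' \<in> cyclic_support G (fst (snd y))" "separates G e (arr_src x) (tail G e')"
    using e supp unfolding core_arcs_def src by blast
  then show "e \<in> core_arcs G x \<union> core_arcs G y"
  proof cases
    case a then show ?thesis by (auto simp: core_arcs_def)
  next
    case b
    from separates_trans[OF this, of "arr_tgt x"] show ?thesis using assms by (auto simp: core_arcs_def)
  next
    case c then show ?thesis by (auto simp: core_arcs_def)
  next
    case d
    from separates_trans[OF d(2), of "arr_tgt x"] d(1) show ?thesis using assms by (auto simp: core_arcs_def)
  qed
qed

lemma core_arcs_prod:
  "xs \<noteq> [] \<Longrightarrow> arr_chain xs \<Longrightarrow>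
     arr_src (arr_prod xs) = arr_src (hd xs) \<and> core_arcs G (arr_prod xs) \<subseteq> (\<Union>x\<in>set xs. core_arcs G x)"
proof (induction xs rule: arr_prod.induct)
  case (2 x y xs)
  then have IH: "arr_src (arr_prod (y # xs)) = arr_src y"
      "core_arcs G (arr_prod (y # xs)) \<subseteq> (\<Union>x\<in>set (y # xs). core_arcs G x)"
    by auto
  have "core_arcs G (arr_comp x (arr_prod (y # xs))) \<subseteq> core_arcs G x \<union> core_arcs G (arr_prod (y # xs))"
    by (rule core_arcs_comp) (use 2 IH in auto)
  moreover have "arr_src (arr_comp x (arr_prod (y # xs))) = arr_src x"
    by (simp add: arr_comp_def arr_src_def)
  ultimately show ?case using IH(2) by auto
qed auto

lemma core_verts_prod:
  assumes "xs \<noteq> []" "arr_chain xs"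
  shows "core_verts G (arr_prod xs) \<subseteq> (\<Union>x\<in>set xs. core_verts G x)"
proof -
  have "arr_src (arr_prod xs) \<in> (\<Union>x\<in>set xs. core_verts G x)"
    using core_arcs_prod[OF assms, of G] assms(1) by (auto simp: core_verts_def intro: bexI[of _ "hd xs"])
  moreover have "\<exists>x\<in>set xs. e \<in> core_arcs G x" if "e \<in> core_arcs G (arr_prod xs)" for e
    using core_arcs_prod[OF assms, of G] that by auto
  ultimately show ?thesis unfolding core_verts_def[of G "arr_prod xs"]
    by (fastforce simp: core_verts_def)
qed

text \<open>A walk must use every arc with nonzero coefficient, hence visits its ends; and it must
  use every arc that separates its start from a vertex it visits.\<close>

lemma core_arcs_span:
  assumes "walk_ok G u w"
  shows "core_arcs G (arrow_of G (u, w)) \<subseteq> fst ` set w"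
proof
  fix e assume e: "e \<in> core_arcs G (arrow_of G (u, w))"
  have visit: "e \<in> fst ` set w" if "separates G e u v" "v \<in> fst (span G (u, w))" for v
  proof (rule ccontr)
    assume "e \<notin> fst ` set w"
    then have "fst ` set w \<subseteq> arcs G - {e}" using walk_ok_arcs[OF assms] by auto
    from walk_links_span[OF assms this that(2)] that(1) show False by (simp add: separates_def)
  qed
  from e consider "e \<in> cyclic_support G (ab_class w)" | "separates G e u (walk_end G u w)"
    | e' where "e' \<in> cyclic_support G (ab_class w)" "separates G e u (tail G e')"
    by (auto simp: core_arcs_def arrow_of_def arr_src_def arr_tgt_def dpath_end_def)
  then show "e \<in> fst ` set w"
  proof cases
    case 1
    then have "Poly_Mapping.lookup (ab_class w) e \<noteq> 0" by (simp add: cyclic_support_def)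
    then show ?thesis by (rule ab_class_lookup_nonzero)
  next
    case 2
    then show ?thesis using visit walk_end_in_span by metis
  next
    case 3
    then have "Poly_Mapping.lookup (ab_class w) e' \<noteq> 0" by (simp add: cyclic_support_def)
    then have "e' \<in> fst ` set w" by (rule ab_class_lookup_nonzero)
    then show ?thesis using visit[OF 3(2)] span_arc_ends[OF assms] by blast
  qed
qed

text \<open>The core is defined from the arrow alone, so the bound by the span holds for every
  representing path and passes to the intersection.\<close>

lemma core_C0:
  assumes "is_dpath G p"
  shows "core_verts G (arrow_of G p) \<subseteq> fst (C0 G (arrow_of G p))"
    and "core_arcs G (arrow_of G p) \<subseteq> snd (C0 G (arrow_of G p))"
proof -
  have "core_arcs G (arrow_of G p) \<subseteq> snd (span G q) \<and> core_verts G (arrow_of G p) \<subseteq> fst (span G q)"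
    if "is_dpath G q" "arrow_of G q = arrow_of G p" for q
  proof -
    obtain u w where q: "q = (u, w)" by (cases q)
    have w: "walk_ok G u w" using that q by (simp add: is_dpath_def)
    have 1: "core_arcs G (arrow_of G p) \<subseteq> fst ` set w"
      using core_arcs_span[OF w] that q by simp
    have 2: "arr_src (arrow_of G p) = u" unfolding that(2)[symmetric] q by (simp add: arrow_of_def arr_src_def)
    have "core_verts G (arrow_of G p) \<subseteq> fst (span G q)"
      using span_arc_ends[OF w] 1 2 by (fastforce simp: core_verts_def q span_def)
    with 1 show ?thesis by (simp add: q span_def)
  qed
  then show "core_verts G (arrow_of G p) \<subseteq> fst (C0 G (arrow_of G p))"
    "core_arcs G (arrow_of G p) \<subseteq> snd (C0 G (arrow_of G p))"
    unfolding C0_def sg_Inter_def fst_conv snd_conv by blast+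
qed

definition core_connected :: "('v,'e) pre_digraph \<Rightarrow> ('v,'e) arrow \<Rightarrow> bool" where
  "core_connected G x \<longleftrightarrow> (\<forall>v\<in>core_verts G x. (arr_src x, v) \<in> (links G (core_arcs G x))\<^sup>*)"

lemma component_core:
  assumes "core_connected G x" "core_verts G x \<subseteq> fst H" "core_arcs G x \<subseteq> snd H"
  shows "core_verts G x \<subseteq> fst (component G H (arr_src x)) \<and>
    core_arcs G x \<subseteq> snd (component G H (arr_src x))"
proof -
  have 1: "(arr_src x, v) \<in> (links G (snd H))\<^sup>*" if "v \<in> core_verts G x" for v
    by (rule links_rtrancl_mono[OF assms(3)]) (use assms(1) that in \<open>simp add: core_connected_def\<close>)
  have 2: "tail G e \<in> core_verts G x \<and> head G e \<in> core_verts G x" if "e \<in> core_arcs G x" for e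
    using that by (auto simp: core_verts_def)
  show ?thesis
    using 1 2 assms(2,3) unfolding component_eq by (auto dest: 2)
qed

text \<open>A connected core inside \<open>C_n\<close> stays inside the component
  \<open>P_n\<close>, and the cores of the factors cover the core of the product. Connectedness is
  assumed for all arrows because the factors are arbitrary.\<close>

lemma core_Cseq:
  assumes conn: "\<And>x. x \<in> arrows G \<Longrightarrow> core_connected G x" and "x \<in> arrows G"
  shows "core_verts G x \<subseteq> fst (Cseq G n x) \<and> core_arcs G x \<subseteq> snd (Cseq G n x)"
  using assms(2)
proof (induction n arbitrary: x)
  case 0
  then show ?case using core_C0 by (fastforce simp: arrows_def)
next
  case (Suc n)
  have IH: "core_verts G y \<subseteq> fst (component G (Cseq G n y) (arr_src y)) \<and>
    core_arcs G y \<subseteq> snd (component G (Cseq G n y) (arr_src y))" if "y \<in> arrows G" for y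
    using component_core conn Suc.IH that by metis
  have "core_verts G x \<subseteq> fst (sg_Union (map (\<lambda>y. component G (Cseq G n y) (arr_src y)) xs)) \<and>
    core_arcs G x \<subseteq> snd (sg_Union (map (\<lambda>y. component G (Cseq G n y) (arr_src y)) xs))"
    if "xs \<in> factorizations G x" for xs
  proof -
    have xs: "xs \<noteq> []" "set xs \<subseteq> arrows G" "arr_chain xs" "arr_prod xs = x"
      using that by (auto simp: factorizations_def)
    have "core_verts G x \<subseteq> (\<Union>y\<in>set xs. core_verts G y)" "core_arcs G x \<subseteq> (\<Union>y\<in>set xs. core_arcs G y)"
      using core_verts_prod[OF xs(1,3), of G] core_arcs_prod[OF xs(1,3), of G] xs(4) by auto
    moreover have *: "core_verts G y \<subseteq> fst (component G (Cseq G n y) (arr_src y))"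
        "core_arcs G y \<subseteq> snd (component G (Cseq G n y) (arr_src y))" if "y \<in> set xs" for y
      using IH[of y] that xs(2) by auto
    have "(\<Union>y\<in>set xs. core_verts G y) \<subseteq> (\<Union>y\<in>set xs. fst (component G (Cseq G n y) (arr_src y)))"
        "(\<Union>y\<in>set xs. core_arcs G y) \<subseteq> (\<Union>y\<in>set xs. snd (component G (Cseq G n y) (arr_src y)))"
      by (rule UN_mono[OF order_refl *(1)], assumption) (rule UN_mono[OF order_refl *(2)], assumption)
    ultimately show ?thesis
      by (simp add: sg_Union_def image_image) (meson order_trans)
  qed
  then show ?case
    unfolding Cseq.simps sg_Inter_def fst_conv snd_conv by blast
qed

lemma core_verts_Plim:
  assumes "\<And>x. x \<in> arrows G \<Longrightarrow> core_connected G x" "x \<in> arrows G"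
  shows "core_verts G x \<subseteq> fst (Plim G x)"
proof -
  have "core_verts G x \<subseteq> fst (Pseq G n x)" for n
    using core_Cseq[OF assms, of n] component_core[OF assms(1)[OF assms(2)], of "Cseq G n x"]
    by (simp add: Pseq_def)
  then show ?thesis by (auto simp: Plim_def sg_Inter_def)
qed

section \<open>Disconnected cores contain a model\<close>

lemma joins_flip: "joins G e A B \<longleftrightarrow> joins G e B A"
  by (auto simp: joins_def)

text \<open>Split a connected set \<open>L\<close> at the edge \<open>uv\<close> by taking the component of \<open>v\<close> in \<open>L - {u}\<close> and
  its complement: every edge between the two parts is incident with \<open>u\<close>.\<close>

lemma connected_set_split:
  assumes "connected_set G L" "u \<in> L" "v \<in> L" "u \<noteq> v"
  obtains M T where "M \<union> T = L" "M \<inter> T = {}" "u \<in> M" "v \<in> T" "connected_set G M" "connected_set G T"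
proof -
  define T where "T = {w. (v, w) \<in> (links G (induced_arcs G (L - {u})))\<^sup>*}"
  define M where "M = L - T"
  have T: "connected_set G T"
    unfolding T_def by (rule connected_set_reach) (auto simp: induced_arcs_def)
  have TL: "T \<subseteq> L - {u}"
    unfolding T_def by (rule links_reach_subset) (use assms(3,4) in \<open>auto simp: induced_arcs_def\<close>)
  have closed: "tail G e \<in> T \<longleftrightarrow> head G e \<in> T" if "e \<in> induced_arcs G (L - {u})" for e
    using links_reach_iff[OF that] by (simp add: T_def)
  \<comment> \<open>\<open>T\<close> is a component of \<open>L - {u}\<close>, so inside
    \<open>L\<close> one can leave \<open>T\<close> only to \<open>u\<close>. A path from
    \<open>u\<close> therefore ends in \<open>T\<close>, or the part after its last visit to
    \<open>u\<close> runs in \<open>M\<close>.\<close>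
  have reach: "w \<in> T \<or> (u, w) \<in> (links G (induced_arcs G M))\<^sup>*"
    if "(u, w) \<in> (links G (induced_arcs G L))\<^sup>*" for w
    using that
  proof induction
    case (step y z)
    show ?case
    proof (cases "z = u \<or> z \<in> T")
      case False
      have yz: "y \<in> L" "z \<in> L" using step(2) by (auto simp: links_def induced_arcs_def)
      have "y \<notin> T"
      proof
        assume "y \<in> T"
        with TL False yz step(2) have "(y, z) \<in> links G (induced_arcs G (L - {u}))"
          by (auto simp: links_def induced_arcs_def)
        with \<open>y \<in> T\<close> have "z \<in> T" by (auto simp: T_def)
        with False show False by simp
      qed
      with False yz step(2) have "(y, z) \<in> links G (induced_arcs G M)"
        by (auto simp: links_def induced_arcs_def M_def)
      with \<open>y \<notin> T\<close> step(3) show ?thesis by (auto intro: rtrancl.rtrancl_into_rtrancl)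
    qed auto
  qed simp
  have u: "u \<in> M" using TL assms(2) by (auto simp: M_def)
  have reach': "(u, w) \<in> (links G (induced_arcs G M))\<^sup>*" if "w \<in> M" for w
    using reach[of w] that assms(1,2) by (auto simp: M_def connected_set_def)
  have "(w, w') \<in> (links G (induced_arcs G M))\<^sup>*" if "w \<in> M" "w' \<in> M" for w w'
    using rtrancl_trans[OF links_rtrancl_sym[OF reach'[OF that(1)]] reach'[OF that(2)]] .
  then have "connected_set G M" using u by (auto simp: connected_set_def)
  moreover have "v \<in> T" by (simp add: T_def)
  ultimately show thesis using that[of M T] T u TL by (auto simp: M_def)
qed

text \<open>A model is not symmetric in \<open>M\<close> and \<open>T\<close>, since
  \<open>s\<close> must end in \<open>M\<close>. If \<open>s\<close> ends in \<open>T\<close>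
  instead, the two sets exchange roles.\<close>

lemma theta_model_of_two_arcs:
  assumes "M \<union> T = L" "M \<inter> T = {}" "connected_set G M" "connected_set G T" "connected_set G S"
    "S \<inter> L = {}" "S \<union> L \<subseteq> verts G"
    "p \<noteq> q" "joins G p M T" "joins G q M T" "s \<noteq> s'" "joins G s S L" "joins G s' S L"
  shows "\<exists>M T S p q s s'. theta_model G M T S p q s s'"
proof -
  \<comment> \<open>Both ends of \<open>p\<close> and \<open>q\<close> lie in \<open>L\<close>,
    whereas \<open>s\<close> and \<open>s'\<close> have an end in \<open>S\<close>.\<close>
  have disj: "p \<notin> {s, s'}" "q \<notin> {s, s'}" using assms by (auto simp: joins_def)
  have "joins G s S M \<or> joins G s S T" using assms by (auto simp: joins_def)
  then show ?thesis
  proof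
    assume "joins G s S M"
    then have "theta_model G M T S p q s s'"
      using assms disj unfolding theta_model_def by auto
    then show ?thesis by blast
  next
    assume "joins G s S T"
    moreover have "joins G p T M" "joins G q T M" "joins G s' S (T \<union> M)"
      using assms joins_flip by (metis, metis, simp add: Un_commute)
    ultimately have "theta_model G T M S p q s s'"
      using assms disj unfolding theta_model_def by auto
    then show ?thesis by blast
  qed
qed

section \<open>The core of the arrow of a fixed walk\<close>

context
  fixes G :: "('v,'e) pre_digraph" and i :: 'v and w :: "'e letter list" and x :: "('v,'e) arrow"
  assumes fin: "fin_digraph G" and conn: "connected G" and walk: "walk_ok G i w"
  defines "x \<equiv> arrow_of G (i, w)"
begin

interpretation fin_digraph G by (fact fin)

lemma arrow_parts: "arr_src x = i" "arr_tgt x = walk_end G i w" "fst (snd x) = ab_class w"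
  by (auto simp: x_def arrow_of_def arr_src_def arr_tgt_def dpath_end_def)

lemma crossing_unique:
  assumes "e \<in> arcs G" "\<And>e'. e' \<in> arcs G \<Longrightarrow> e' \<noteq> e \<Longrightarrow> Poly_Mapping.lookup (ab_class w) e' \<noteq> 0
       \<Longrightarrow> crossing G X e' = 0"
  shows "Poly_Mapping.lookup (ab_class w) e * crossing G X e = of_bool (i \<in> X) - of_bool (walk_end G i w \<in> X)"
proof -
  have "(\<Sum>e\<in>arcs G. Poly_Mapping.lookup (ab_class w) e * crossing G X e)
      = (\<Sum>e\<in>{e}. Poly_Mapping.lookup (ab_class w) e * crossing G X e)"
    by (rule sum.mono_neutral_right) (use assms in auto)
  with net_crossing[OF fin walk, of X] show ?thesis by simp
qed

lemma crossing_none: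
  assumes "\<And>e. e \<in> arcs G \<Longrightarrow> Poly_Mapping.lookup (ab_class w) e \<noteq> 0 \<Longrightarrow> crossing G X e = 0"
  shows "i \<in> X \<longleftrightarrow> walk_end G i w \<in> X"
proof -
  have "(\<Sum>e\<in>arcs G. Poly_Mapping.lookup (ab_class w) e * crossing G X e) = 0"
    by (rule sum.neutral) (use assms in auto)
  with net_crossing[OF fin walk, of X] show ?thesis by (auto split: if_splits)
qed

text \<open>Only the bridge case needs an argument. A bridge is the only arc crossing the cut given
  by its tail side, so by net crossing a nonzero coefficient puts the ends of the walk on opposite
  sides, and the bridge separates them.\<close>

lemma support_core:
  assumes "e \<in> arcs G" "Poly_Mapping.lookup (ab_class w) e \<noteq> 0" "tail G e \<noteq> head G e"
  shows "e \<in> core_arcs G x"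
proof (cases "separates G e (tail G e) (head G e)")
  case False
  with assms show ?thesis by (auto simp: core_arcs_def cyclic_support_def arrow_parts)
next
  case True
  define X where "X = {v. (tail G e, v) \<in> (links G (arcs G - {e}))\<^sup>*}"
  have closed: "tail G e' \<in> X \<longleftrightarrow> head G e' \<in> X" if "e' \<in> arcs G" "e' \<noteq> e" for e'
    using links_reach_iff[of e' "arcs G - {e}" "tail G e" G] that by (simp add: X_def)
  have "crossing G X e = 1" using True by (simp add: crossing_def X_def separates_def)
  then have "Poly_Mapping.lookup (ab_class w) e = of_bool (i \<in> X) - of_bool (walk_end G i w \<in> X)"
    using crossing_unique[OF assms(1), of X] closed by (simp add: crossing_def)
  with assms(2) have side: "(i \<in> X) \<noteq> (walk_end G i w \<in> X)" by auto
  have "separates G e i (walk_end G i w)"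
  proof (rule ccontr)
    assume "\<not> ?thesis"
    with assms(1) have *: "(i, walk_end G i w) \<in> (links G (arcs G - {e}))\<^sup>*" by (simp add: separates_def)
    from links_rtrancl_closed[OF *, of X] links_rtrancl_closed[OF links_rtrancl_sym[OF *], of X] side closed
    show False by blast
  qed
  then show ?thesis by (simp add: core_arcs_def arrow_parts)
qed

text \<open>Otherwise the component \<open>L\<close> of \<open>e\<close> in the core carries a circulation, so it splits into two parts with
  two edges between them, while a single edge from \<open>L\<close> towards \<open>i\<close> would itself belong to the core.\<close>

lemma cyclic_support_reached:
  assumes nomodel: "\<nexists>M T S p q s s'. theta_model G M T S p q s s'"
    and e: "e \<in> cyclic_support G (ab_class w)"
    and tgt: "(i, walk_end G i w) \<in> (links G (core_arcs G x))\<^sup>*"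
  shows "(i, tail G e) \<in> (links G (core_arcs G x))\<^sup>*"
proof (rule ccontr)
  assume nr: "(i, tail G e) \<notin> (links G (core_arcs G x))\<^sup>*"
  define L where "L = {v. (tail G e, v) \<in> (links G (core_arcs G x))\<^sup>*}"
  have e': "e \<in> arcs G" "Poly_Mapping.lookup (ab_class w) e \<noteq> 0" "tail G e \<noteq> head G e"
    using e by (auto simp: cyclic_support_def)
  have eL: "tail G e \<in> L" "head G e \<in> L"
    using support_core[OF e'] linksI(1)[of e] by (auto simp: L_def)
  have Lclosed: "tail G h \<in> L \<longleftrightarrow> head G h \<in> L" if "h \<in> core_arcs G x" for h
    using links_reach_iff[OF that] by (simp add: L_def)
  have iL: "i \<notin> L" using nr by (auto simp: L_def dest: links_rtrancl_sym)
  have jL: "walk_end G i w \<notin> L"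
    using iL links_rtrancl_closed[OF links_rtrancl_sym[OF tgt] _ Lclosed] by blast
  have "connected_set G L"
    unfolding L_def by (rule connected_set_reach[OF core_arcs_subset])
  from connected_set_split[OF this eL e'(3)] obtain M T where
    MT: "M \<union> T = L" "M \<inter> T = {}" "tail G e \<in> M" "head G e \<in> T" "connected_set G M" "connected_set G T" .
  have Lv: "L \<subseteq> verts G"
    unfolding L_def by (rule links_reach_subset) (use core_arcs_subset[of G x] e'(1) in auto)
  have pe: "joins G e M T" using MT e' by (simp add: joins_def)
  \<comment> \<open>Both ends of the walk lie outside \<open>L\<close>, so the net crossing of
    \<open>T\<close> is zero and \<open>e\<close> cannot be the only supported arc in this
    cut.\<close>
  have "\<exists>h\<in>arcs G. h \<noteq> e \<and> Poly_Mapping.lookup (ab_class w) h \<noteq> 0 \<and> crossing G T h \<noteq> 0"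
  proof (rule ccontr)
    assume "\<not> ?thesis"
    then have "Poly_Mapping.lookup (ab_class w) e * crossing G T e = of_bool (i \<in> T) - of_bool (walk_end G i w \<in> T)"
      by (intro crossing_unique e') auto
    moreover have "crossing G T e = -1" using MT by (auto simp: crossing_def)
    moreover have "i \<notin> T" "walk_end G i w \<notin> T" using MT iL jL by auto
    ultimately show False using e'(2) by simp
  qed
  then obtain q where q: "q \<in> arcs G" "q \<noteq> e" "Poly_Mapping.lookup (ab_class w) q \<noteq> 0" "crossing G T q \<noteq> 0"
    by blast
  \<comment> \<open>No core arc leaves \<open>L\<close>, so the end of \<open>q\<close> outside
    \<open>T\<close> lies in \<open>M\<close>.\<close>
  then have "q \<in> core_arcs G x" by (intro support_core) (auto simp: crossing_def)
  then have pq: "joins G q M T"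
    using Lclosed[of q] q MT by (auto simp: joins_def crossing_def split: if_splits)
  \<comment> \<open>The component of \<open>i\<close> in the complement of \<open>L\<close>: any arc
    of \<open>G\<close> leaving it must end in \<open>L\<close>.\<close>
  define S where "S = {v. (i, v) \<in> (links G (induced_arcs G (verts G - L)))\<^sup>*}"
  have iv: "i \<in> verts G" using walk_ok_verts[OF walk] by simp
  have S: "connected_set G S"
    unfolding S_def by (rule connected_set_reach) (auto simp: induced_arcs_def)
  have Sv: "S \<subseteq> verts G - L"
    unfolding S_def by (rule links_reach_subset) (use iv iL in \<open>auto simp: induced_arcs_def\<close>)
  have iS: "i \<in> S" by (simp add: S_def)
  have Sout: "joins G h S L" if "h \<in> arcs G" "(tail G h \<in> S) \<noteq> (head G h \<in> S)" for h
  proof (cases "h \<in> induced_arcs G (verts G - L)")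
    case True
    then show ?thesis using that links_reach_iff[OF True, of i] by (simp add: S_def)
  next
    case False
    then show ?thesis using that Sv by (auto simp: joins_def induced_arcs_def)
  qed
  have unique: "h = h'" if "joins G h S L" "joins G h' S L" for h h'
  proof (rule ccontr)
    assume "h \<noteq> h'"
    then have "\<exists>M T S p q s s'. theta_model G M T S p q s s'"
      by (intro theta_model_of_two_arcs[OF MT(1,2,5,6) S _ _ q(2)[symmetric] pe pq _ that]) (use Sv Lv in auto)
    with nomodel show False by simp
  qed
  have "\<exists>s\<in>arcs G. (tail G s \<in> S) \<noteq> (head G s \<in> S)"
  proof (rule ccontr)
    assume "\<not> ?thesis"
    then have "tail G e \<in> S"
      using links_rtrancl_closed[OF connected_links[OF conn iv, of "tail G e"] iS] e'(1) by auto
    with eL Sv show False by blast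
  qed
  then obtain s where s: "s \<in> arcs G" "joins G s S L" using Sout by blast
  \<comment> \<open>By \<open>unique\<close>, \<open>s\<close> is the only arc leaving
    \<open>S\<close>, which contains \<open>i\<close> but not the tail of \<open>e\<close>.\<close>
  have "separates G s i (tail G e)"
  proof (rule ccontr)
    assume "\<not> ?thesis"
    then have "(i, tail G e) \<in> (links G (arcs G - {s}))\<^sup>*" using s by (simp add: separates_def)
    from links_rtrancl_closed[OF this iS] Sout unique[OF s(2)] have "tail G e \<in> S" by blast
    with eL Sv show False by blast
  qed
  then have "s \<in> core_arcs G x" using e by (auto simp: core_arcs_def arrow_parts)
  from Lclosed[OF this] s(2) Sv show False by (auto simp: joins_def)
qed

text \<open>Let \<open>K\<close> be the set reached from \<open>i\<close> in the core. Every
  supported arc that is not a loop is a core arc, so none crosses \<open>K\<close>, and net crossing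
  puts the target in \<open>K\<close>. This is needed to reach the cyclic support; the separating
  arcs come last, each lying on a core path to a vertex already in \<open>K\<close>.\<close>

lemma core_connected_if_no_theta_model:
  assumes nomodel: "\<nexists>M T S p q s s'. theta_model G M T S p q s s'"
  shows "core_connected G x \<and> walk_end G i w \<in> core_verts G x"
proof -
  define K where "K = {v. (i, v) \<in> (links G (core_arcs G x))\<^sup>*}"
  have Kclosed: "tail G h \<in> K \<longleftrightarrow> head G h \<in> K" if "h \<in> core_arcs G x" for h
    using links_reach_iff[OF that] by (simp add: K_def)
  have iK: "i \<in> K" by (simp add: K_def)
  have "i \<in> K \<longleftrightarrow> walk_end G i w \<in> K"
  proof (rule crossing_none)
    fix e assume "e \<in> arcs G" "Poly_Mapping.lookup (ab_class w) e \<noteq> 0"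
    then show "crossing G K e = 0"
      using support_core[of e] Kclosed[of e] by (cases "tail G e = head G e") (auto simp: crossing_def)
  qed
  with iK have jK: "walk_end G i w \<in> K" by simp
  have cK: "tail G e \<in> K" if "e \<in> cyclic_support G (ab_class w)" for e
    using cyclic_support_reached[OF nomodel that] jK by (simp add: K_def)
  \<comment> \<open>Otherwise a path from \<open>i\<close> to \<open>v\<close> made of core arcs
    within \<open>K\<close> would avoid \<open>e\<close>, contradicting separation.\<close>
  have sepK: "tail G e \<in> K" if "separates G e i v" "v \<in> K" for e v
  proof (rule ccontr)
    assume e: "tail G e \<notin> K"
    have "(i, v) \<in> (links G (core_arcs G x))\<^sup>*" using that(2) by (simp add: K_def)
    from links_rtrancl_restrict[OF this iK Kclosed]
    have "(i, v) \<in> (links G {e \<in> core_arcs G x. tail G e \<in> K \<and> head G e \<in> K})\<^sup>*" .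
    moreover have "{e \<in> core_arcs G x. tail G e \<in> K \<and> head G e \<in> K} \<subseteq> arcs G - {e}"
      using e core_arcs_subset[of G x] by auto
    ultimately have "(i, v) \<in> (links G (arcs G - {e}))\<^sup>*" by (rule links_rtrancl_mono[rotated])
    with that(1) show False by (simp add: separates_def)
  qed
  have all: "tail G e \<in> K" if "e \<in> core_arcs G x" for e
    using that cK sepK jK by (auto simp: core_arcs_def arrow_parts)
  have "core_verts G x \<subseteq> K"
    using all Kclosed iK by (auto simp: core_verts_def arrow_parts)
  then have "core_connected G x"
    by (auto simp: core_connected_def arrow_parts K_def)
  moreover have "walk_end G i w \<in> core_verts G x"
  proof -
    have "(i, walk_end G i w) \<in> (links G (core_arcs G x))\<^sup>*" using jK by (simp add: K_def)
    \<comment> \<open>A nonempty core path ends at an end of a core arc; an empty one ends at the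
      source.\<close>
    then show ?thesis
      by (cases rule: rtranclE) (auto simp: core_verts_def arrow_parts elim!: linksE)
  qed
  ultimately show ?thesis by blast
qed

end

lemma no_breaking_path_if_no_theta_model:
  assumes "fin_digraph G" "connected G" "\<nexists>M T S p q s s'. theta_model G M T S p q s s'"
  shows "\<not> breaking_path_Ab G p"
proof
  assume "breaking_path_Ab G p"
  then have p: "is_dpath G p" "dpath_end G p \<notin> fst (Plim G (arrow_of G p))"
    by (auto simp: breaking_path_Ab_def)
  have core: "core_connected G (arrow_of G q) \<and> dpath_end G q \<in> core_verts G (arrow_of G q)"
    if "is_dpath G q" for q
    using core_connected_if_no_theta_model[OF assms(1,2) _ assms(3), of "fst q" "snd q"] that
    by (simp add: is_dpath_def dpath_end_def)
  then have "core_verts G (arrow_of G p) \<subseteq> fst (Plim G (arrow_of G p))"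
    using p(1) by (intro core_verts_Plim) (auto simp: arrows_def)
  with core[OF p(1)] p(2) show False by blast
qed

section \<open>A model yields a breaking path\<close>

definition walk_within :: "('v,'e) pre_digraph \<Rightarrow> 'e set \<Rightarrow> 'v \<Rightarrow> 'e letter list \<Rightarrow> 'v \<Rightarrow> bool" where
  "walk_within G E u w v \<longleftrightarrow> walk_ok G u w \<and> walk_end G u w = v \<and> fst ` set w \<subseteq> E"

lemma walk_within_append:
  "walk_within G E u w v \<Longrightarrow> walk_within G E v w' v' \<Longrightarrow> walk_within G E u (w @ w') v'"
  by (auto simp: walk_within_def walk_ok_append walk_end_append)

lemma walk_within_inverse: "walk_within G E u w v \<Longrightarrow> walk_within G E v (inverse_word w) u"
  by (auto simp: walk_within_def set_inverse_word walk_inverse)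

lemma walk_within_mono: "walk_within G E u w v \<Longrightarrow> E \<subseteq> F \<Longrightarrow> walk_within G F u w v"
  by (auto simp: walk_within_def)

lemma joins_walk:
  assumes "joins G e A B" "wf_digraph G"
  obtains a b l where "a \<in> A" "b \<in> B" "walk_within G {e} a [l] b"
proof -
  interpret wf_digraph G by fact
  have e: "e \<in> arcs G" using assms by (simp add: joins_def)
  consider "tail G e \<in> A" "head G e \<in> B" | "head G e \<in> A" "tail G e \<in> B"
    using assms by (auto simp: joins_def)
  then show thesis
  proof cases
    case 1
    with e show thesis
      by (intro that[of "tail G e" "head G e" "(e, True)"]) (auto simp: walk_within_def dsrc_def dtgt_def)
  next
    case 2
    with e show thesis
      by (intro that[of "head G e" "tail G e" "(e, False)"]) (auto simp: walk_within_def dsrc_def dtgt_def)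
  qed
qed

lemma connected_set_walk:
  assumes "connected_set G X" "u \<in> X" "v \<in> X" "X \<subseteq> verts G" "wf_digraph G"
  obtains w where "walk_within G (induced_arcs G X) u w v"
proof -
  have "(u, v) \<in> (links G (induced_arcs G X))\<^sup>*" using assms by (simp add: connected_set_def)
  from links_walk[OF this _ _ assms(5)] assms(2,4) that show thesis
    by (auto simp: walk_within_def induced_arcs_def)
qed

lemma C0_arcs_le:
  assumes "walk_within G E u w v"
  shows "snd (C0 G (arrow_of G (u, w))) \<subseteq> E"
proof -
  have "is_dpath G (u, w)" using assms by (simp add: is_dpath_def walk_within_def)
  then have "span G (u, w) \<in> {span G q | q. is_dpath G q \<and> arrow_of G q = arrow_of G (u, w)}"
    by blast
  then have "snd (C0 G (arrow_of G (u, w))) \<subseteq> snd (span G (u, w))"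
    unfolding C0_def sg_Inter_def snd_conv by blast
  also have "\<dots> \<subseteq> E" using assms by (simp add: span_def walk_within_def)
  finally show ?thesis .
qed

lemma Cseq_Suc_arcs_le:
  assumes "xs \<in> factorizations G x"
  shows "snd (Cseq G (Suc n) x) \<subseteq> (\<Union>y\<in>set xs. snd (Pseq G n y))"
proof -
  let ?U = "\<lambda>xs. sg_Union (map (\<lambda>y. component G (Cseq G n y) (arr_src y)) xs)"
  have "?U xs \<in> {?U xs | xs. xs \<in> factorizations G x}"
    using assms by blast
  then have "snd (Cseq G (Suc n) x) \<subseteq> snd (?U xs)"
    unfolding Cseq.simps sg_Inter_def snd_conv by blast
  then show ?thesis by (simp add: sg_Union_def Pseq_def image_image)
qed

lemma Pseq_arcs: "snd (Pseq G n x) \<subseteq> {e \<in> snd (Cseq G n x). tail G e \<in> fst (Pseq G n x)}"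
  by (auto simp: Pseq_def component_eq)

text \<open>The path \<open>y\<close> runs through \<open>s\<close> and \<open>p\<close>, the coterminal path \<open>y'\<close> through \<open>s\<close> and \<open>q\<close>. The loop
  \<open>y y'\<^sup>-\<^sup>1\<close> is also the class of a loop through \<open>s'\<close> instead of \<open>s\<close>, so its support is cut off from its base
  point; hence \<open>y = (y y'\<^sup>-\<^sup>1) y'\<close> shows that neither \<open>p\<close> nor \<open>q\<close> survives to level 1.\<close>

lemma breaking_path_if_theta_model:
  assumes model: "theta_model G M T S p q s s'" and wf: "wf_digraph G" and conn: "connected G"
  shows "\<exists>r. breaking_path_Ab G r"
proof -
  note m = model[unfolded theta_model_def]
  have sub: "M \<subseteq> verts G" "T \<subseteq> verts G" "S \<subseteq> verts G" and cs: "connected_set G M" "connected_set G T" "connected_set G S"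
    using m by auto
  obtain s0 m0 ls where s: "s0 \<in> S" "m0 \<in> M" "walk_within G {s} s0 [ls] m0"
    using joins_walk[of G s S M] m wf by metis
  obtain m1 t1 lp where p: "m1 \<in> M" "t1 \<in> T" "walk_within G {p} m1 [lp] t1"
    using joins_walk[of G p M T] m wf by metis
  obtain m2 t2 lq where q: "m2 \<in> M" "t2 \<in> T" "walk_within G {q} m2 [lq] t2"
    using joins_walk[of G q M T] m wf by metis
  obtain s1 n1 ls' where s': "s1 \<in> S" "n1 \<in> M \<union> T" "walk_within G {s'} s1 [ls'] n1"
    using joins_walk[of G s' S "M \<union> T"] m wf by metis
  let ?iM = "induced_arcs G M" and ?iT = "induced_arcs G T" and ?iS = "induced_arcs G S"
    and ?iN = "induced_arcs G (M \<union> T)"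
  obtain \<alpha> where \<alpha>: "walk_within G ?iM m0 \<alpha> m1" using connected_set_walk[OF cs(1) s(2) p(1) sub(1) wf] .
  obtain \<beta> where \<beta>: "walk_within G ?iM m0 \<beta> m2" using connected_set_walk[OF cs(1) s(2) q(1) sub(1) wf] .
  obtain \<gamma> where \<gamma>: "walk_within G ?iT t2 \<gamma> t1" using connected_set_walk[OF cs(2) q(2) p(2) sub(2) wf] .
  obtain \<sigma> where \<sigma>: "walk_within G ?iS s0 \<sigma> s1" using connected_set_walk[OF cs(3) s(1) s'(1) sub(3) wf] .
  have iN: "?iM \<subseteq> ?iN" "?iT \<subseteq> ?iN" "p \<in> ?iN" "q \<in> ?iN"
    using m by (auto simp: induced_arcs_def joins_def)
  \<comment> \<open>A closed walk at \<open>m0\<close> inside \<open>M\<close> and \<open>T\<close>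
    that goes out through \<open>p\<close> and back through \<open>q\<close>.\<close>
  define c where "c = (\<alpha> @ [lp]) @ inverse_word (\<beta> @ [lq] @ \<gamma>)"
  have c: "walk_within G ?iN m0 c m0"
    unfolding c_def
    by (intro walk_within_append walk_within_inverse; (rule walk_within_mono, (rule \<alpha> \<beta> \<gamma> p q)))
       (use iN in auto)
  have "\<exists>\<rho>. walk_within G ?iN n1 \<rho> m0"
  proof (cases "n1 \<in> M")
    case True
    obtain \<rho> where "walk_within G ?iM n1 \<rho> m0" using connected_set_walk[OF cs(1) True s(2) sub(1) wf] .
    then show ?thesis using walk_within_mono iN(1) by metis
  next
    case False
    then have "n1 \<in> T" using s'(2) by simp
    then obtain \<tau> where \<tau>: "walk_within G ?iT n1 \<tau> t1" using connected_set_walk[OF cs(2) _ p(2) sub(2) wf] by metis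
    \<comment> \<open>If \<open>s'\<close> ends in \<open>T\<close>, the return to \<open>m0\<close>
      runs through \<open>p\<close> backwards.\<close>
    have "walk_within G ?iN n1 (\<tau> @ inverse_word [lp] @ inverse_word \<alpha>) m0"
      by (intro walk_within_append walk_within_inverse; (rule walk_within_mono, (rule \<tau> \<alpha> p)))
         (use iN in auto)
    then show ?thesis by blast
  qed
  then obtain \<rho> where \<rho>: "walk_within G ?iN n1 \<rho> m0" by blast
  define r where "r = \<sigma> @ [ls'] @ \<rho>"
  define y where "y = [ls] @ \<alpha> @ [lp]"
  define y' where "y' = [ls] @ \<beta> @ [lq] @ \<gamma>"
  define z1 where "z1 = y @ inverse_word y'"
  define z2 where "z2 = r @ c @ inverse_word r"
  have y: "walk_within G ({s, p} \<union> ?iM) s0 y t1"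
    unfolding y_def by (intro walk_within_append; (rule walk_within_mono, (rule \<alpha> p s))) auto
  have y': "walk_within G ({s, q} \<union> ?iM \<union> ?iT) s0 y' t1"
    unfolding y'_def by (intro walk_within_append; (rule walk_within_mono, (rule \<beta> \<gamma> q s))) auto
  have z1: "walk_within G ({s, p, q} \<union> ?iM \<union> ?iT) s0 z1 s0"
    unfolding z1_def
    by (intro walk_within_append walk_within_inverse; (rule walk_within_mono, (rule y y'))) auto
  have r: "walk_within G (?iS \<union> {s'} \<union> ?iN) s0 r m0"
    unfolding r_def by (intro walk_within_append; (rule walk_within_mono, (rule \<sigma> s' \<rho>))) auto
  have z2: "walk_within G (?iS \<union> {s'} \<union> ?iN) s0 z2 s0"
    unfolding z2_def
    by (intro walk_within_append walk_within_inverse; (rule walk_within_mono, (rule r c))) auto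
  \<comment> \<open>Commutativity enters here: \<open>z1\<close> is \<open>c\<close> conjugated by
    \<open>ls\<close> and \<open>z2\<close> is \<open>c\<close> conjugated by \<open>r\<close>, so
    both have the class of \<open>c\<close>.\<close>
  have cls: "ab_class z1 = ab_class z2" "ab_class z1 + ab_class y' = ab_class y"
    by (simp_all only: z1_def z2_def c_def y_def y'_def ab_class_append ab_class_inverse)
       (simp_all add: algebra_simps)
  define Y where "Y = arrow_of G (s0, y)"
  define Y' where "Y' = arrow_of G (s0, y')"
  define Z where "Z = arrow_of G (s0, z1)"
  have dp: "is_dpath G (s0, y)" "is_dpath G (s0, y')" "is_dpath G (s0, z1)"
    using y y' z1 by (auto simp: is_dpath_def walk_within_def)
  have Z2: "Z = arrow_of G (s0, z2)"
    using z1 z2 cls(1) by (simp add: Z_def arrow_of_def dpath_end_def walk_within_def)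
  have src: "arr_src Y = s0" "arr_src Y' = s0" "arr_src Z = s0" "arr_tgt Z = s0"
    using z1 by (auto simp: Y_def Y'_def Z_def arr_src_def arr_tgt_def arrow_of_def dpath_end_def walk_within_def)
  have arr: "Y \<in> arrows G" "Y' \<in> arrows G" "Z \<in> arrows G"
    using dp by (auto simp: arrows_def Y_def Y'_def Z_def)
  have "arr_comp Z Y' = Y"
    using y y' cls(2) by (simp add: Z_def Y'_def Y_def arr_comp_def arrow_of_def dpath_end_def walk_within_def)
  then have fac: "[Y] \<in> factorizations G Y" "[Z, Y'] \<in> factorizations G Y"
    using arr src by (auto simp: factorizations_def)
  have s0: "s0 \<notin> M \<union> T" using s(1) m by auto
  \<comment> \<open>The two bounds come from \<open>z1\<close> and \<open>z2\<close>. As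
    \<open>s\<close> occurs only in the first, the surviving arcs lie inside
    \<open>M \<union> T\<close>; \<open>s0\<close> does not, so \<open>P_0(Z)\<close> contains no
    arc and no vertex other than \<open>s0\<close>.\<close>
  have "snd (C0 G Z) \<subseteq> ({s, p, q} \<union> ?iM \<union> ?iT) \<inter> (?iS \<union> {s'} \<union> ?iN)"
    using C0_arcs_le[OF z1] C0_arcs_le[OF z2] unfolding Z_def[symmetric] Z2[symmetric] by (rule Int_greatest)
  moreover have "s \<notin> ?iS \<union> {s'} \<union> ?iN" using m by (auto simp: induced_arcs_def joins_def)
  ultimately have C0Z: "snd (C0 G Z) \<subseteq> ?iN" using iN by auto
  have P0Z: "fst (Pseq G 0 Z) \<subseteq> {s0}"
    unfolding Pseq_def Cseq.simps src
    by (rule component_subset) (use C0Z s0 in \<open>auto simp: induced_arcs_def\<close>)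
  have "snd (Pseq G 0 Z) = {}"
    using Pseq_arcs[of G 0 Z] P0Z C0Z s0 by (auto simp: induced_arcs_def)
  then have "snd (Cseq G 1 Y) \<subseteq> snd (Pseq G 0 Y')"
    using Cseq_Suc_arcs_le[OF fac(2), of 0] by simp
  also have "\<dots> \<subseteq> snd (C0 G Y')" using Pseq_arcs[of G 0 Y'] by auto
  also have "\<dots> \<subseteq> {s, q} \<union> ?iM \<union> ?iT"
    unfolding Y'_def by (rule C0_arcs_le[OF y'])
  finally have 1: "snd (Cseq G 1 Y) \<subseteq> {s, q} \<union> ?iM \<union> ?iT" .
  have "snd (Cseq G 1 Y) \<subseteq> snd (Pseq G 0 Y)"
    using Cseq_Suc_arcs_le[OF fac(1), of 0] by simp
  also have "\<dots> \<subseteq> snd (C0 G Y)" using Pseq_arcs[of G 0 Y] by auto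
  also have "\<dots> \<subseteq> {s, p} \<union> ?iM"
    unfolding Y_def by (rule C0_arcs_le[OF y])
  finally have "snd (Cseq G 1 Y) \<subseteq> {s, p} \<union> ?iM" .
  moreover have "p \<notin> {s, q} \<union> ?iM \<union> ?iT" using m by (auto simp: induced_arcs_def joins_def)
  ultimately have C1: "snd (Cseq G 1 Y) \<subseteq> {s} \<union> ?iM" using 1 by auto
  \<comment> \<open>The surviving arcs are \<open>s\<close> and arcs inside \<open>M\<close>, none
    of which leads out of \<open>S \<union> M\<close> into \<open>T\<close>.\<close>
  have sSM: "tail G s \<in> S \<union> M \<and> head G s \<in> S \<union> M" using m by (auto simp: joins_def)
  have "fst (Pseq G 1 Y) \<subseteq> S \<union> M"
    unfolding Pseq_def src
  proof (rule component_subset)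
    show "s0 \<in> S \<union> M" using s(1) by simp
    show "tail G e \<in> S \<union> M \<longleftrightarrow> head G e \<in> S \<union> M" if "e \<in> snd (Cseq G 1 Y)" for e
      using C1 that sSM by (auto simp: induced_arcs_def)
  qed
  then have "t1 \<notin> fst (Pseq G 1 Y)" using p(2) m by auto
  then have "t1 \<notin> fst (Plim G Y)" by (auto simp: Plim_def sg_Inter_def)
  moreover have "dpath_end G (s0, y) = t1" using y by (simp add: dpath_end_def walk_within_def)
  ultimately have "breaking_path_Ab G (s0, y)"
    using conn dp(1) by (simp add: breaking_path_Ab_def Y_def)
  then show ?thesis by blast
qed

section \<open>Models and minors\<close>

lemma connected_set_singleton: "connected_set G {v}"
  by (simp add: connected_set_def)

text \<open>Comparing ends as unordered pairs treats deletions and reversals at once.\<close>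

lemma theta_model_supergraph:
  assumes "theta_model H M T S p q s s'"
    "verts H \<subseteq> verts G" "arcs H \<subseteq> arcs G"
    "\<And>e. e \<in> arcs H \<Longrightarrow> {tail H e, head H e} = {tail G e, head G e}"
  shows "theta_model G M T S p q s s'"
proof -
  have j: "joins G e A B" if "joins H e A B" for e A B
    using that assms(3) assms(4)[of e] by (auto simp: joins_def doubleton_eq_iff)
  have "links H (induced_arcs H X) \<subseteq> links G (induced_arcs G X)" for X
  proof
    fix uv assume "uv \<in> links H (induced_arcs H X)"
    then obtain e where "e \<in> arcs H" "tail H e \<in> X" "head H e \<in> X"
        "uv = (tail H e, head H e) \<or> uv = (head H e, tail H e)"
      by (auto simp: links_def induced_arcs_def)
    then show "uv \<in> links G (induced_arcs G X)"
      using assms(3) assms(4)[of e] by (auto simp: links_def induced_arcs_def doubleton_eq_iff intro!: bexI[of _ e])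
  qed
  then have c: "connected_set G X" if "connected_set H X" for X
    using that rtrancl_mono[of "links H (induced_arcs H X)" "links G (induced_arcs G X)"]
    unfolding connected_set_def by blast
  show ?thesis
    using assms(1,2) unfolding theta_model_def by (auto intro: c j)
qed

lemma contract_arc_simps:
  "verts (contract_arc G e) = verts G - {head G e}"
  "arcs (contract_arc G e) = arcs G - {e}"
  "tail (contract_arc G e) a = (if tail G a = head G e then tail G e else tail G a)"
  "head (contract_arc G e) a = (if head G a = head G e then tail G e else head G a)"
  by (simp_all add: contract_arc_def)

text \<open>The preimage of \<open>X\<close> under the contraction map, which sends the head of
  \<open>e\<close> to its tail.\<close>

definition expand_set :: "('v,'e) pre_digraph \<Rightarrow> 'e \<Rightarrow> 'v set \<Rightarrow> 'v set" where
  "expand_set G e X = (X - {head G e}) \<union> (if tail G e \<in> X then {head G e} else {})"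

lemma expand_set_contract:
  assumes "tail G e \<noteq> head G e"
  shows "tail G a \<in> expand_set G e X \<longleftrightarrow> tail (contract_arc G e) a \<in> X"
    and "head G a \<in> expand_set G e X \<longleftrightarrow> head (contract_arc G e) a \<in> X"
  using assms by (auto simp: expand_set_def contract_arc_simps)

text \<open>If the merged vertex is in \<open>X\<close>, the preimage contains both ends of
  \<open>e\<close> and induces \<open>e\<close>, so each vertex is linked to its image. Links of the
  contracted graph thus lift to paths.\<close>

lemma connected_set_expand:
  assumes e: "e \<in> arcs G" "tail G e \<noteq> head G e"
    and X: "connected_set (contract_arc G e) X" "X \<subseteq> verts (contract_arc G e)"
  shows "connected_set G (expand_set G e X)"
proof -
  let ?H = "contract_arc G e" and ?Y = "expand_set G e X"
  let ?R = "(links G (induced_arcs G ?Y))\<^sup>*"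
  define \<phi> where "\<phi> v = (if v = head G e then tail G e else v)" for v
  have hX: "head G e \<notin> X" using X(2) by (auto simp: contract_arc_simps)
  have \<phi>: "(v, \<phi> v) \<in> ?R \<and> (\<phi> v, v) \<in> ?R" if "\<phi> v \<in> X" for v
  proof (cases "v = head G e")
    case True
    with that e have "e \<in> induced_arcs G ?Y" by (auto simp: induced_arcs_def expand_set_def \<phi>_def)
    then show ?thesis using True by (auto simp: \<phi>_def intro: linksI r_into_rtrancl)
  qed (simp add: \<phi>_def)
  have th: "tail ?H a = \<phi> (tail G a)" "head ?H a = \<phi> (head G a)" for a
    by (auto simp: contract_arc_simps \<phi>_def)
  have step: "(u, v) \<in> ?R" if uv: "(u, v) \<in> links ?H (induced_arcs ?H X)" for u v
    using uv
  proof (cases rule: linksE)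
    case (1 a)
    then have a: "\<phi> (tail G a) \<in> X" "\<phi> (head G a) \<in> X" "a \<in> induced_arcs G ?Y"
      using expand_set_contract[OF e(2)] by (auto simp: induced_arcs_def contract_arc_simps(2) th)
    have "(\<phi> (tail G a), \<phi> (head G a)) \<in> ?R"
      by (meson \<phi> a linksI(1) rtrancl_trans r_into_rtrancl)
    then show ?thesis using 1 th by simp
  next
    case (2 a)
    then have a: "\<phi> (tail G a) \<in> X" "\<phi> (head G a) \<in> X" "a \<in> induced_arcs G ?Y"
      using expand_set_contract[OF e(2)] by (auto simp: induced_arcs_def contract_arc_simps(2) th)
    have "(\<phi> (head G a), \<phi> (tail G a)) \<in> ?R"
      by (meson \<phi> a linksI(2) rtrancl_trans r_into_rtrancl)
    then show ?thesis using 2 th by simp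
  qed
  have path: "(u, v) \<in> ?R" if "(u, v) \<in> (links ?H (induced_arcs ?H X))\<^sup>*" for u v
    using that by induction (auto intro: rtrancl_trans step)
  have Y: "\<phi> v \<in> X" if "v \<in> ?Y" for v
    using that hX by (auto simp: expand_set_def \<phi>_def split: if_splits)
  have "(u, v) \<in> ?R" if "u \<in> ?Y" "v \<in> ?Y" for u v
  proof -
    have "(\<phi> u, \<phi> v) \<in> ?R" using path X(1) Y that by (simp add: connected_set_def)
    with \<phi> Y that show ?thesis by (meson rtrancl_trans)
  qed
  moreover have "?Y \<noteq> {}" using X(1) hX by (auto simp: connected_set_def expand_set_def)
  ultimately show ?thesis by (simp add: connected_set_def)
qed

lemma theta_model_expand:
  assumes e: "e \<in> arcs G" "tail G e \<noteq> head G e" and wf: "wf_digraph G"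
    and model: "theta_model (contract_arc G e) M T S p q s s'"
  shows "theta_model G (expand_set G e M) (expand_set G e T) (expand_set G e S) p q s s'"
proof -
  interpret wf_digraph G by fact
  have j: "joins G a (expand_set G e A) (expand_set G e B)" if "joins (contract_arc G e) a A B" for a A B
    using that expand_set_contract[OF e(2)] by (auto simp: joins_def contract_arc_simps(2))
  have un: "expand_set G e M \<union> expand_set G e T = expand_set G e (M \<union> T)"
    by (auto simp: expand_set_def)
  have sub: "expand_set G e A \<subseteq> verts G" if "A \<subseteq> verts (contract_arc G e)" for A
    using that e by (auto simp: expand_set_def contract_arc_simps split: if_splits)
  have disj: "expand_set G e A \<inter> expand_set G e B = {}" if "A \<inter> B = {}" for A B
    using that by (auto simp: expand_set_def)
  note m = model[unfolded theta_model_def]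
  have vs: "M \<subseteq> verts (contract_arc G e)" "T \<subseteq> verts (contract_arc G e)" "S \<subseteq> verts (contract_arc G e)"
    using m by auto
  have "expand_set G e M \<union> expand_set G e T \<union> expand_set G e S \<subseteq> verts G"
    using vs[THEN sub] by simp
  moreover have "connected_set G (expand_set G e M)" "connected_set G (expand_set G e T)"
      "connected_set G (expand_set G e S)"
    using m connected_set_expand[OF e _ vs(1)] connected_set_expand[OF e _ vs(2)]
      connected_set_expand[OF e _ vs(3)] by blast+
  moreover have "expand_set G e M \<inter> expand_set G e T = {}" "expand_set G e M \<inter> expand_set G e S = {}"
      "expand_set G e T \<inter> expand_set G e S = {}"
    using m by (simp_all add: disj)
  ultimately show ?thesis
    unfolding theta_model_def un using m by (simp add: j)
qed

lemma wf_contract_arc: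
  assumes "wf_digraph G" "e \<in> arcs G" "tail G e \<noteq> head G e"
  shows "wf_digraph (contract_arc G e)"
proof -
  interpret wf_digraph G by fact
  show ?thesis by unfold_locales (use assms in \<open>auto simp: contract_arc_simps\<close>)
qed

lemma wf_reverse_arc:
  assumes "wf_digraph G"
  shows "wf_digraph (reverse_arc G e)"
proof -
  interpret wf_digraph G by fact
  show ?thesis by unfold_locales (auto simp: reverse_arc_def)
qed

lemma theta_model_minor_step:
  assumes step: "minor_step G H" and wf: "wf_digraph G"
  shows "wf_digraph H \<and> ((\<exists>M T S p q s s'. theta_model H M T S p q s s') \<longrightarrow>
    (\<exists>M T S p q s s'. theta_model G M T S p q s s'))"
proof -
  interpret wf_digraph G by fact
  from step consider (c) e where "e \<in> arcs G" "tail G e \<noteq> head G e" "H = contract_arc G e"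
    | (d) e where "H = del_arc e" | (v) v where "H = del_vert v"
    | (r) e where "H = reverse_arc G e"
    unfolding minor_step_def by blast
  then show ?thesis
  proof cases
    case c
    then show ?thesis using theta_model_expand[OF c(1,2) wf] wf_contract_arc[OF wf c(1,2)] by blast
  next
    case d
    then show ?thesis using theta_model_supergraph[of H _ _ _ _ _ _ _ G] wf_digraph_del_arc
      by (metis (no_types, lifting) Diff_subset arcs_del_arc head_del_arc order_refl tail_del_arc verts_del_arc)
  next
    case v
    have "theta_model G M T S p q s s'" if "theta_model H M T S p q s s'" for M T S p q s s'
      by (rule theta_model_supergraph[OF that]) (auto simp: v del_vert_simps)
    then show ?thesis using v wf_digraph_del_vert by blast
  next
    case r
    have "theta_model G M T S p q s s'" if "theta_model H M T S p q s s'" for M T S p q s s'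
      by (rule theta_model_supergraph[OF that]) (auto simp: r reverse_arc_def)
    then show ?thesis using r wf_reverse_arc[OF wf] by blast
  qed
qed

lemma theta_model_minor_steps:
  "minor_step\<^sup>*\<^sup>* G H \<Longrightarrow> wf_digraph G \<Longrightarrow> theta_model H M T S p q s s' \<Longrightarrow>
     \<exists>M T S p q s s'. theta_model G M T S p q s s'"
proof (induction rule: converse_rtranclp_induct)
  case (step G' G'')
  then show ?case using theta_model_minor_step[OF step(1,4)] by blast
qed blast

lemma theta_model_if_is_minor:
  assumes "wf_digraph G" "is_minor Theta1 G \<or> is_minor Theta2 G"
  shows "\<exists>M T S p q s s'. theta_model G M T S p q s s'"
proof -
  from assms(2) obtain D H where D: "D = Theta1 \<or> D = Theta2" "minor_step\<^sup>*\<^sup>* G H" "digraph_iso D H"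
    by (auto simp: is_minor_def)
  then obtain f where f: "pre_digraph.digraph_isomorphism D f" "H = app_iso f D"
    by (auto simp: digraph_iso_def)
  have D': "verts D = {0, 1, 2}" "arcs D = {0, 1, 2, 3}"
    using D(1) by (auto simp: Theta1_def Theta2_def)
  define V where "V = iso_verts f"
  define A where "A = iso_arcs f"
  have V: "V 0 \<noteq> V 1" "V 0 \<noteq> V 2" "V 1 \<noteq> V 2"
    and A: "distinct [A 0, A 1, A 2, A 3]"
    using f(1) by (auto simp: pre_digraph.digraph_isomorphism_def D' V_def A_def inj_on_def)
  have th: "tail H (A a) = V (tail D a)" "head H (A a) = V (head D a)" if "a \<in> arcs D" for a
    using that f by (auto simp: pre_digraph.digraph_isomorphism_def V_def A_def)
  have H: "verts H = {V 0, V 1, V 2}" "arcs H = {A 0, A 1, A 2, A 3}"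
    using f(2) by (auto simp: D' V_def A_def)
  \<comment> \<open>The vertices \<open>u\<close>, \<open>v\<close>, \<open>w\<close> serve as
    \<open>M\<close>, \<open>T\<close>, \<open>S\<close>, and the arcs \<open>a\<close>,
    \<open>b\<close>, \<open>c\<close>, \<open>d\<close> as \<open>p\<close>, \<open>q\<close>,
    \<open>s\<close>, \<open>s'\<close>; \<open>d\<close> reaches \<open>T\<close> in
    \<open>Theta1\<close> and \<open>M\<close> in \<open>Theta2\<close>.\<close>
  have "theta_model H {V 0} {V 1} {V 2} (A 0) (A 1) (A 2) (A 3)"
    unfolding theta_model_def joins_def using D(1) V A
    by (auto simp: connected_set_singleton H th D' Theta1_def Theta2_def)
  then show ?thesis by (rule theta_model_minor_steps[OF D(2) assms(1)])
qed

section \<open>A graph with a model reduces to one of the two minors\<close>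

lemma is_minor_step: "minor_step G H \<Longrightarrow> is_minor D H \<Longrightarrow> is_minor D G"
  unfolding is_minor_def by (meson converse_rtranclp_into_rtranclp)

text \<open>The contraction map carries paths in \<open>X\<close> to paths in its image, with
  \<open>e\<close> becoming stationary. As both ends of \<open>e\<close> or neither lie in
  \<open>X\<close>, that image is \<open>X\<close> without the head.\<close>

lemma connected_set_contract:
  assumes e: "tail G e \<noteq> head G e" and X: "connected_set G X" "tail G e \<in> X \<longleftrightarrow> head G e \<in> X"
  shows "connected_set (contract_arc G e) (X - {head G e})"
proof -
  let ?H = "contract_arc G e"
  let ?R = "(links ?H (induced_arcs ?H (X - {head G e})))\<^sup>*"
  define \<phi> where "\<phi> v = (if v = head G e then tail G e else v)" for v
  have th: "tail ?H a = \<phi> (tail G a)" "head ?H a = \<phi> (head G a)" for a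
    by (auto simp: contract_arc_simps \<phi>_def)
  have \<phi>: "\<phi> v \<in> X - {head G e}" if "v \<in> X" for v
    using that e X(2) by (auto simp: \<phi>_def)
  have arc: "(\<phi> (tail G a), \<phi> (head G a)) \<in> ?R" if a: "a \<in> induced_arcs G X" for a
  proof (cases "a = e")
    case True
    then show ?thesis by (simp add: \<phi>_def)
  next
    case False
    with a \<phi> have "a \<in> induced_arcs ?H (X - {head G e})"
      by (auto simp: induced_arcs_def contract_arc_simps(2) th)
    from linksI(1)[OF this, of ?H] show ?thesis by (simp add: th)
  qed
  have path: "(\<phi> u, \<phi> v) \<in> ?R" if "(u, v) \<in> (links G (induced_arcs G X))\<^sup>*" for u v
    using that
  proof induction
    case (step y z)
    from step(2) have "(\<phi> y, \<phi> z) \<in> ?R"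
      by (cases rule: linksE) (auto intro: arc links_rtrancl_sym)
    with step(3) show ?case by (rule rtrancl_trans)
  qed simp
  have "(u, v) \<in> ?R" if "u \<in> X - {head G e}" "v \<in> X - {head G e}" for u v
  proof -
    have "\<phi> u = u" "\<phi> v = v" using that by (auto simp: \<phi>_def)
    moreover have "(\<phi> u, \<phi> v) \<in> ?R" using that X(1) by (intro path) (auto simp: connected_set_def)
    ultimately show ?thesis by simp
  qed
  moreover have "X - {head G e} \<noteq> {}" using X \<phi> by (auto simp: connected_set_def)
  ultimately show ?thesis by (simp add: connected_set_def)
qed

text \<open>An arc inside one of the three sets is none of \<open>p\<close>, \<open>q\<close>,
  \<open>s\<close>, \<open>s'\<close>, and by disjointness every set of the model contains both of
  its ends or neither.\<close>

lemma theta_model_contract: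
  assumes model: "theta_model G M T S p q s s'" and e: "e \<in> arcs G" "tail G e \<noteq> head G e"
    and X: "X \<in> {M, T, S}" "tail G e \<in> X" "head G e \<in> X"
  shows "theta_model (contract_arc G e) (M - {head G e}) (T - {head G e}) (S - {head G e}) p q s s'"
proof -
  let ?h = "head G e" and ?H = "contract_arc G e"
  note m = model[unfolded theta_model_def]
  have same: "tail G e \<in> Y \<longleftrightarrow> ?h \<in> Y" if "Y \<in> {M, T, S, M \<union> T}" for Y
    using that X m by auto
  have ne: "e \<notin> {p, q, s, s'}" using X m by (auto simp: joins_def)
  have ends: "tail ?H a \<in> Y - {?h} \<longleftrightarrow> tail G a \<in> Y" "head ?H a \<in> Y - {?h} \<longleftrightarrow> head G a \<in> Y"
    if "Y \<in> {M, T, S, M \<union> T}" for a Y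
    using same[OF that] e(2) by (auto simp: contract_arc_simps)
  have j: "joins ?H a (A - {?h}) (B - {?h})"
    if "joins G a A B" "a \<in> {p, q, s, s'}" "A \<in> {M, T, S, M \<union> T}" "B \<in> {M, T, S, M \<union> T}" for a A B
  proof -
    have "a \<in> arcs ?H" using that(1,2) ne by (auto simp: joins_def contract_arc_simps(2))
    with that(1) show ?thesis unfolding joins_def ends[OF that(3)] ends[OF that(4)] by blast
  qed
  have c: "connected_set ?H (Y - {?h})" if "Y \<in> {M, T, S}" for Y
  proof (rule connected_set_contract[OF e(2)])
    show "connected_set G Y" using that m by blast
    show "tail G e \<in> Y \<longleftrightarrow> ?h \<in> Y" by (rule same) (use that in blast)
  qed
  have jm: "joins G p M T" "joins G q M T" "joins G s S M" "joins G s' S (M \<union> T)"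
    using m by auto
  have js: "joins ?H p (M - {?h}) (T - {?h})" "joins ?H q (M - {?h}) (T - {?h})"
      "joins ?H s (S - {?h}) (M - {?h})" "joins ?H s' (S - {?h}) (M \<union> T - {?h})"
    by (intro j jm; simp)+
  have un: "M - {?h} \<union> (T - {?h}) = M \<union> T - {?h}" by blast
  have "M \<union> T - {?h} \<union> (S - {?h}) \<subseteq> verts ?H"
    using m by (auto simp: contract_arc_simps)
  moreover have "(M - {?h}) \<inter> (T - {?h}) = {}" "(M - {?h}) \<inter> (S - {?h}) = {}"
      "(T - {?h}) \<inter> (S - {?h}) = {}" "distinct [p, q, s, s']"
    using m by auto
  ultimately show ?thesis
    unfolding theta_model_def un by (intro conjI js c) simp_all
qed

text \<open>Deletion may destroy connectedness of the three sets, hence it is required again in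
  \<open>H\<close>.\<close>

lemma theta_model_subgraph:
  assumes "theta_model G M T S p q s s'" "tail H = tail G" "head H = head G"
    "M \<union> T \<union> S \<subseteq> verts H" "{p, q, s, s'} \<subseteq> arcs H"
    "connected_set H M" "connected_set H T" "connected_set H S"
  shows "theta_model H M T S p q s s'"
  using assms by (auto simp: theta_model_def joins_def)

lemma connected_set_loops_only:
  assumes "connected_set G X" "\<And>e. e \<in> arcs G \<Longrightarrow> tail G e \<in> X \<Longrightarrow> head G e \<in> X \<Longrightarrow> tail G e = head G e"
  obtains x where "X = {x}"
proof -
  obtain x where x: "x \<in> X" using assms(1) by (auto simp: connected_set_def)
  have "y = x" if "y \<in> X" for y
  proof -
    have path: "(x, y) \<in> (links G (induced_arcs G X))\<^sup>*" using assms(1) x that by (simp add: connected_set_def)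
    have eq: "tail G e = head G e" if "e \<in> induced_arcs G X" for e
      by (rule assms(2)) (use that in \<open>auto simp: induced_arcs_def\<close>)
    have "y \<in> {x}" by (rule links_rtrancl_closed[OF path]) (simp_all add: eq)
    then show ?thesis by simp
  qed
  with x that show thesis by blast
qed

definition reverse_arcs :: "('v,'e) pre_digraph \<Rightarrow> 'e set \<Rightarrow> ('v,'e) pre_digraph" where
  "reverse_arcs G R = \<lparr> verts = verts G, arcs = arcs G,
     tail = (\<lambda>a. if a \<in> R then head G a else tail G a), head = (\<lambda>a. if a \<in> R then tail G a else head G a) \<rparr>"

lemma minor_steps_reverse_arcs:
  "finite R \<Longrightarrow> R \<subseteq> arcs G \<Longrightarrow> minor_step\<^sup>*\<^sup>* G (reverse_arcs G R)"
proof (induction R rule: finite_induct)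
  case empty
  have "reverse_arcs G {} = G" by (simp add: reverse_arcs_def)
  then show ?case by simp
next
  case (insert e R)
  have "reverse_arcs G (insert e R) = reverse_arc (reverse_arcs G R) e"
    using insert(2) by (auto simp: reverse_arcs_def reverse_arc_def fun_eq_iff)
  moreover have "e \<in> arcs (reverse_arcs G R)" using insert.prems by (simp add: reverse_arcs_def)
  ultimately have "minor_step (reverse_arcs G R) (reverse_arcs G (insert e R))"
    unfolding minor_step_def by blast
  with insert show ?case by (auto intro: rtranclp.rtrancl_into_rtrancl)
qed

lemma is_minor_if_singleton_theta_model:
  assumes model: "theta_model G {m} {t} {w} p q s s'"
    and G: "verts G = {m, t, w}" "arcs G = {p, q, s, s'}"
  shows "is_minor Theta1 G \<or> is_minor Theta2 G"
proof -
  note m = model[unfolded theta_model_def]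
  have d: "m \<noteq> t" "m \<noteq> w" "t \<noteq> w" "distinct [p, q, s, s']" using m by auto
  \<comment> \<open>The arcs of the model that point against the orientation chosen in
    \<open>Theta1\<close> and \<open>Theta2\<close>.\<close>
  define R where "R = {e \<in> {p, q}. tail G e \<noteq> m} \<union> {e \<in> {s, s'}. tail G e \<noteq> w}"
  define H where "H = reverse_arcs G R"
  have H: "minor_step\<^sup>*\<^sup>* G H" "verts H = {m, t, w}" "arcs H = {p, q, s, s'}"
    unfolding H_def by (rule minor_steps_reverse_arcs) (auto simp: R_def G reverse_arcs_def)
  have ends: "tail H p = m" "head H p = t" "tail H q = m" "head H q = t" "tail H s = w" "head H s = m"
      "tail H s' = w" "head H s' \<in> {m, t}"
    using m d by (auto simp: H_def R_def reverse_arcs_def joins_def)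
  \<comment> \<open>Taking the full functions \<open>head H\<close> and \<open>tail H\<close> makes
    \<open>app_iso f D\<close> equal to \<open>H\<close> as a record, including values off the
    arcs.\<close>
  define f where "f = \<lparr> iso_verts = (\<lambda>n::nat. if n = 0 then m else if n = 1 then t else w),
      iso_arcs = (\<lambda>n::nat. if n = 0 then p else if n = 1 then q else if n = 2 then s else s'),
      iso_head = head H, iso_tail = tail H \<rparr>"
  define D where "D = (if head H s' = t then Theta1 else Theta2)"
  have D: "verts D = {0, 1, 2}" "arcs D = {0, 1, 2, 3}"
      "tail D = (\<lambda>e. if e = 2 \<or> e = 3 then 2 else 0)"
      "head D = (\<lambda>e. if e = 2 \<or> e = 3 \<and> head H s' = m then 0 else 1)"
    using ends(8) d by (auto simp: D_def Theta1_def Theta2_def fun_eq_iff)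
  have "wf_digraph D" by unfold_locales (auto simp: D)
  moreover have "iso_verts f (tail D a) = iso_tail f (iso_arcs f a) \<and> iso_verts f (head D a) = iso_head f (iso_arcs f a)"
    if "a \<in> arcs D" for a
    using that ends d by (auto simp: D f_def)
  ultimately have "pre_digraph.digraph_isomorphism D f"
    using d unfolding pre_digraph.digraph_isomorphism_def by (auto simp: D f_def inj_on_def)
  moreover have "H = app_iso f D"
    by (rule pre_digraph.equality) (auto simp: D f_def H(2,3))
  ultimately have "digraph_iso D H" by (auto simp: digraph_iso_def)
  with H(1) have "is_minor D G" by (auto simp: is_minor_def)
  then show ?thesis by (simp add: D_def split: if_splits)
qed

text \<open>Induction on the size of the graph: delete vertices outside the model, then contract
  arcs inside its sets, and delete surplus arcs only when the sets are singletons, whose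
  connectedness no deletion can harm. The four named arcs survive throughout.\<close>

lemma is_minor_if_theta_model:
  assumes "fin_digraph G" "theta_model G M T S p q s s'"
  shows "is_minor Theta1 G \<or> is_minor Theta2 G"
  using assms
proof (induction "card (verts G) + card (arcs G)" arbitrary: G M T S rule: less_induct)
  case less
  interpret fin_digraph G by (fact less.prems(1))
  have wf: "wf_digraph G" by unfold_locales
  note m = less.prems(2)[unfolded theta_model_def]
  have pq: "{p, q, s, s'} \<subseteq> arcs G" using m by (auto simp: joins_def)
  have step: ?case if "minor_step G H" "theta_model H M' T' S' p q s s'" "fin_digraph H"
      "card (verts H) + card (arcs H) < card (verts G) + card (arcs G)" for H M' T' S'
    using less.hyps[OF that(4,3,2)] is_minor_step[OF that(1)] by blast
  consider (v) v where "v \<in> verts G" "v \<notin> M \<union> T \<union> S"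
    | (c) e X where "e \<in> arcs G" "tail G e \<noteq> head G e" "X \<in> {M, T, S}" "tail G e \<in> X" "head G e \<in> X"
    | (s) "verts G = M \<union> T \<union> S"
       "\<And>e X. e \<in> arcs G \<Longrightarrow> X \<in> {M, T, S} \<Longrightarrow> tail G e \<in> X \<Longrightarrow> head G e \<in> X \<Longrightarrow> tail G e = head G e"
    using m by blast
  then show ?case
  proof cases
    case v
    have ind: "induced_arcs (del_vert v) X = induced_arcs G X" if "X \<in> {M, T, S}" for X
      using that v(2) by (auto simp: induced_arcs_def del_vert_simps)
    have cs: "connected_set (del_vert v) X" if "X \<in> {M, T, S}" for X
      using m ind[OF that] that by (auto simp: connected_set_def links_def del_vert_simps)
    have "theta_model (del_vert v) M T S p q s s'"
    proof (rule theta_model_subgraph[OF less.prems(2)])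
      show "{p, q, s, s'} \<subseteq> arcs (del_vert v)"
        using m v(2) by (auto simp: joins_def del_vert_simps)
    qed (use m v(2) cs in \<open>auto simp: del_vert_simps\<close>)
    moreover have "card (verts (del_vert v)) < card (verts G)" "card (arcs (del_vert v)) \<le> card (arcs G)"
      unfolding del_vert_simps by (rule card_Diff1_less, simp, rule v(1)) (rule card_mono, auto)
    moreover have "minor_step G (del_vert v)" using v(1) by (auto simp: minor_step_def)
    ultimately show ?thesis using step fin_digraph_del_vert by (metis add_less_le_mono)
  next
    case c
    have "fin_digraph (contract_arc G e)"
      using wf_digraph.fin_digraphI[OF wf_contract_arc[OF wf c(1,2)]] by (simp add: contract_arc_simps)
    moreover have "minor_step G (contract_arc G e)" using c(1,2) by (auto simp: minor_step_def)
    moreover have "card (verts (contract_arc G e)) \<le> card (verts G)" "card (arcs (contract_arc G e)) < card (arcs G)"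
      unfolding contract_arc_simps by (rule card_mono, simp, blast) (rule card_Diff1_less, simp, rule c(1))
    ultimately show ?thesis using step theta_model_contract[OF less.prems(2) c] by (metis add_le_less_mono)
  next
    case s
    obtain x y z where xyz: "M = {x}" "T = {y}" "S = {z}"
      using connected_set_loops_only[of G M] connected_set_loops_only[of G T] connected_set_loops_only[of G S] m s(2)
      by (metis insertI1 insertI2)
    show ?thesis
    proof (cases "arcs G = {p, q, s, s'}")
      case True
      then show ?thesis
        using is_minor_if_singleton_theta_model[of G x y z p q s s'] less.prems(2) s(1) xyz by auto
    next
      case False
      then obtain a where a: "a \<in> arcs G" "a \<notin> {p, q, s, s'}" using pq by blast
      have "theta_model (del_arc a) M T S p q s s'"
      proof (rule theta_model_subgraph[OF less.prems(2)])
        show "{p, q, s, s'} \<subseteq> arcs (del_arc a)" using pq a by auto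
      qed (use m in \<open>auto simp: xyz connected_set_singleton\<close>)
      moreover have "card (arcs (del_arc a)) < card (arcs G)"
        unfolding arcs_del_arc by (rule card_Diff1_less, simp, rule a(1))
      moreover have "minor_step G (del_arc a)" using a(1) by (auto simp: minor_step_def)
      ultimately show ?thesis using step fin_digraph_del_arc by (metis add_strict_left_mono verts_del_arc)
    qed
  qed
qed

theorem theorem4p1:
  fixes G :: "('v, 'e) pre_digraph"
  assumes "fin_digraph G" and "connected G"
  shows "(\<exists>p. breaking_path_Ab G p) \<longleftrightarrow> is_minor Theta1 G \<or> is_minor Theta2 G"
proof -
  have wf: "wf_digraph G" using assms(1) by (simp add: fin_digraph_def)
  have "(\<exists>p. breaking_path_Ab G p) \<longleftrightarrow> (\<exists>M T S p q s s'. theta_model G M T S p q s s')"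
    using breaking_path_if_theta_model[OF _ wf assms(2)] no_breaking_path_if_no_theta_model[OF assms] by blast
  also have "\<dots> \<longleftrightarrow> is_minor Theta1 G \<or> is_minor Theta2 G"
    using theta_model_if_is_minor[OF wf] is_minor_if_theta_model[OF assms(1)] by blast
  finally show ?thesis .
qed

end
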